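(* Let $\Lambda=\{1,\dots,M\}$ with $M\ge1$, and let $C$ be a complex $\Lambda\times\Lambda$ matrix with positive Hermitian part. Let $a,b\in\Lambda$ (not necessarily distinct) and let $X\subset\Lambda\setminus\{a,b\}$. Then $$\int_{\mathbb R^{2M}}d\mu_C\,\bar\phi_a\phi_b\prod_{x\in X}(1+\phi_x\bar\phi_x)=\sum_{\omega\in\mathcal S_{a,b}(X)}C^\omega\int_{\mathbb R^{2M}}d\mu_C\prod_{x\in X\setminus\omega}(1+\phi_x\bar\phi_x),$$ $$\int_{\mathbb R^{2M}}d\mu_C\prod_{x\in X}(1+\phi_x\bar\phi_x)=\sum_{\Gamma\in\mathcal G(X)}C^\Gamma,$$ and, finally, $$G^{\rm loop}_{a,b}=\int_{\mathbb R^{2M}}d\mu_C\,\bar\phi_a\phi_b\prod_{x\in\Lambda:\,x\ne a,b}(1+\phi_x\bar\phi_x),$$ where $G^{\rm loop}_{a,b}=\sum_{\omega\in\mathcal S_{a,b}}\sum_{\Gamma\in\mathcal G(\Lambda\setminus\omega)}C^\omega C^\Gamma$.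
   Context: Positive Hermitian part: $\sum_{x,y}\phi_x(C_{x,y}+\overline{C_{y,x}})\bar\phi_y>0$ for all nonzero $\phi\in\mathbb C^M$. Gaussian measure: write $\phi_x=u_x+iv_x$, $\bar\phi_x=u_x-iv_x$ with $(u_x,v_x)_{x\in\Lambda}\in\mathbb R^{2M}$. With $A=C^{-1}$ and $\phi A\bar\phi=\sum_{x,y}\phi_xA_{x,y}\bar\phi_y$, the (in general complex) Gaussian measure with covariance $C$ is $d\mu_C=\frac1{Z_C}e^{-\phi A\bar\phi}\prod_{x}d\bar\phi_xd\phi_x$, where $d\bar\phi_xd\phi_x=2i\,du_xdv_x$ and $Z_C=\int_{\mathbb R^{2M}}e^{-\phi A\bar\phi}\prod_xd\bar\phi_xd\phi_x$ is the normalization, so that $\int d\mu_C=1$. Walks: a self-avoiding walk from $a$ to $b$ is a sequence $\omega=(x_0=a,x_1,\dots,x_n=b)$, $n\ge1$, with $x_1,\dots,x_{n-1}$ distinct points of $\Lambda\setminus\{a,b\}$; $\mathcal S_{a,b}$ is the set of all of these and $\mathcal S_{a,b}(X)$ the subset of those with $x_1,\dots,x_{n-1}\in X$. $C^\omega=\prod_{i=1}^nC_{x_{i-1},x_i}$. In set differences such as $X\setminus\omega$ and $\Lambda\setminus\omega$, $\omega$ stands for its set of vertices $\{x_0,\dots,x_n\}$. Loops: a loop is an unrooted directed cycle of distinct vertices in the complete graph on $\Lambda$, including self-loops joining a vertex to itself by a single edge. For $X\subset\Lambda$, $\mathcal G(X)$ is the set of all finite collections $\Gamma=\{\gamma_1,\dots,\gamma_m\}$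 (including $\Gamma=\varnothing$) of pairwise vertex-disjoint loops using only vertices in $X$. $C^\Gamma$ is the product of $C_{x,y}$ over all directed edges $(x,y)$ of the loops in $\Gamma$. Empty products equal $1$. *)

theory Defs
  imports "HOL-Analysis.Analysis"
begin

text \<open>
  The index set \<open>\<Lambda>\<close> is \<open>UNIV\<close> of a finite type \<open>'n\<close>, with \<open>M = CARD('n) \<ge> 1\<close>;
  \<open>C $ x $ y\<close> is the entry \<open>C\<^sub>x\<^sub>,\<^sub>y\<close>.
\<close>

text \<open>
  The sum below is always real; \<open>z > 0\<close> for complex \<open>z\<close> is spelled out as
  \<open>z \<in> \<real> \<and> 0 < Re z\<close>.
\<close>
definition positive_hermitian_part :: "complex ^ 'n ^ 'n \<Rightarrow> bool" where
  "positive_hermitian_part C \<longleftrightarrow>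
     (\<forall>\<phi> :: complex ^ 'n. \<phi> \<noteq> 0 \<longrightarrow>
        (\<Sum>x\<in>UNIV. \<Sum>y\<in>UNIV. \<phi> $ x * (C $ x $ y + cnj (C $ y $ x)) * cnj (\<phi> $ y)) \<in> \<real> \<and>
        0 < Re (\<Sum>x\<in>UNIV. \<Sum>y\<in>UNIV. \<phi> $ x * (C $ x $ y + cnj (C $ y $ x)) * cnj (\<phi> $ y)))"

definition complex_field :: "(real ^ 'n) \<times> (real ^ 'n) \<Rightarrow> complex ^ 'n" where
  "complex_field = (\<lambda>(u, v). \<chi> x. Complex (u $ x) (v $ x))"

text \<open>The integral of \<open>F(\<phi>) \<Prod>\<^sub>x d\<phi>\<^sub>x\<^sup>* d\<phi>\<^sub>x\<close>, where each
  \<open>d\<phi>\<^sub>x\<^sup>* d\<phi>\<^sub>x\<close> (star: complex conjugate) stands for \<open>2i du\<^sub>x dv\<^sub>x\<close>.\<close>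
definition field_integral :: "(complex ^ 'n \<Rightarrow> complex) \<Rightarrow> complex" where
  "field_integral F =
     (LINT w | (lborel :: ((real ^ 'n) \<times> (real ^ 'n)) measure).
        F (complex_field w) * (\<Prod>x\<in>(UNIV :: 'n set). 2 * \<i>))"

definition gauss_weight :: "complex ^ 'n ^ 'n \<Rightarrow> complex ^ 'n \<Rightarrow> complex" where
  "gauss_weight C \<phi> =
     exp (- (\<Sum>x\<in>UNIV. \<Sum>y\<in>UNIV. \<phi> $ x * matrix_inv C $ x $ y * cnj (\<phi> $ y)))"

definition gauss_Z :: "complex ^ 'n ^ 'n \<Rightarrow> complex" where
  "gauss_Z C = field_integral (gauss_weight C)"

text \<open>Integration against the normalised complex Gaussian measure \<open>d\<mu>\<^sub>C\<close>, given through its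
  density since it is in general not a positive measure.\<close>
definition gauss_integral :: "complex ^ 'n ^ 'n \<Rightarrow> (complex ^ 'n \<Rightarrow> complex) \<Rightarrow> complex" where
  "gauss_integral C F = 1 / gauss_Z C * field_integral (\<lambda>\<phi>. gauss_weight C \<phi> * F \<phi>)"

text \<open>A walk is the list \<open>[x\<^sub>0, \<dots>, x\<^sub>n]\<close>; the list \<open>p\<close> below consists of its interior vertices
  and may be empty, so that \<open>[a, b]\<close> is a walk even if \<open>a = b\<close>.\<close>
definition saws_in :: "'n set \<Rightarrow> 'n \<Rightarrow> 'n \<Rightarrow> 'n list set" where
  "saws_in X a b =
     {a # p @ [b] | p. distinct p \<and> set p \<subseteq> UNIV - {a, b} \<and> set p \<subseteq> X}"

abbreviation saws :: "'n \<Rightarrow> 'n \<Rightarrow> 'n list set" where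
  "saws \<equiv> saws_in UNIV"

definition walk_weight :: "complex ^ 'n ^ 'n \<Rightarrow> 'n list \<Rightarrow> complex" where
  "walk_weight C \<omega> = (\<Prod>i = 1..length \<omega> - 1. C $ (\<omega> ! (i - 1)) $ (\<omega> ! i))"

text \<open>A loop is represented by its set of directed edges, which determines the list of its
  vertices exactly up to rotation. A one-element list gives a self-loop.\<close>
definition cycle_edges :: "'n list \<Rightarrow> ('n \<times> 'n) set" where
  "cycle_edges xs = {(xs ! i, xs ! (Suc i mod length xs)) | i. i < length xs}"

definition loops :: "('n \<times> 'n) set set" where
  "loops = {cycle_edges xs | xs. xs \<noteq> [] \<and> distinct xs}"

text \<open>\<open>Field \<gamma>\<close> is the vertex set of the loop \<open>\<gamma>\<close>.\<close>
definition loop_configs :: "'n set \<Rightarrow> ('n \<times> 'n) set set set" where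
  "loop_configs X =
     {\<Gamma>. finite \<Gamma> \<and> \<Gamma> \<subseteq> loops \<and> (\<forall>\<gamma>\<in>\<Gamma>. Field \<gamma> \<subseteq> X) \<and>
         pairwise (\<lambda>\<gamma> \<gamma>'. Field \<gamma> \<inter> Field \<gamma>' = {}) \<Gamma>}"

definition loop_weight :: "complex ^ 'n ^ 'n \<Rightarrow> ('n \<times> 'n) set set \<Rightarrow> complex" where
  "loop_weight C \<Gamma> = (\<Prod>\<gamma>\<in>\<Gamma>. \<Prod>(x, y)\<in>\<gamma>. C $ x $ y)"

definition G_loop :: "complex ^ 'n ^ 'n \<Rightarrow> 'n \<Rightarrow> 'n \<Rightarrow> complex" where
  "G_loop C a b =
     (\<Sum>\<omega>\<in>saws a b. \<Sum>\<Gamma>\<in>loop_configs (UNIV - set \<omega>). walk_weight C \<omega> * loop_weight C \<Gamma>)"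

end

theory Submission
  imports Defs "HOL-Probability.Distributions"
begin

text \<open>
  The identities rest on Gaussian integration by parts,
  \<open>E[\<phi>\<^sub>b F] = \<Sum>\<^sub>y C\<^sub>y\<^sub>b E[\<partial>F/\<partial>(cnj \<phi>\<^sub>y)]\<close> (\<open>moment_component_mult\<close>). Apply it to
  \<open>F = cnj \<phi>\<^sub>a \<Prod>\<^bsub>x\<in>X\<^esub> (1 + \<phi>\<^sub>x cnj \<phi>\<^sub>x)\<close>. If the derivative hits \<open>cnj \<phi>\<^sub>a\<close>, the result is a single step from
  \<open>a\<close> to \<open>b\<close> with the product intact. If it hits the factor of \<open>y \<in> X\<close>, that factor is replaced by
  \<open>\<phi>\<^sub>y\<close>, the step from \<open>y\<close> to \<open>b\<close> has been split off, and what is left is the same expectation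
  with \<open>b\<close> replaced by \<open>y\<close> and \<open>X\<close> by \<open>X - {y}\<close>. Iterating, one traces a walk from \<open>a\<close> to \<open>b\<close> backwards; since a
  visited vertex has lost its factor, the walk is self-avoiding, and the factors that survive are those
  of the vertices it misses (\<open>moment_two_point_paths\<close>).

  For the loop expansion one expands a single factor \<open>1 + \<phi>\<^sub>x cnj \<phi>\<^sub>x\<close>. The term \<open>1\<close> leaves the product
  over \<open>X - {x}\<close>; the other term is the two-point expectation with \<open>a = b = x\<close>, and a self-avoiding walk from \<open>x\<close>
  to \<open>x\<close> is a loop through \<open>x\<close>. The sum over loop configurations satisfies the same recursion
  (\<open>sum_loop_configs_insert\<close>), because at most one loop passes through \<open>x\<close>. The last identity
  combines the other two for \<open>X = \<Lambda> - {a, b}\<close>.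

  On the analytic side, \<open>A = C\<^sup>-\<^sup>1\<close> inherits a positive Hermitian part from \<open>C\<close>, so the weight is
  dominated by a real Gaussian. Integration by parts is translation invariance of Lebesgue measure,
  differentiated under the integral (\<open>integral_directional_derivative_zero\<close>). It holds for the
  unnormalised integral, so the normalisation has to be shown to be nonzero separately; this is not evident, as the
  weight oscillates: along the segment from the Hermitian part of \<open>A\<close> to \<open>A\<close>, integration by parts
  bounds the derivative of the normalisation by a constant multiple of the normalisation itself, so it
  cannot reach zero (\<open>moment_one_nonzero\<close>).
\<close>

section \<open>Differentiation under the integral and translation invariance\<close>

text \<open>The Gaussian factorises over an orthonormal basis, so its integral is a finite power of the
  one-dimensional one, whose integrand is a multiple of a normal density.\<close>
lemma integrable_gaussian:
  fixes \<delta> :: real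
  assumes "\<delta> > 0"
  shows "integrable lborel (\<lambda>x::'a::euclidean_space. exp (- \<delta> * (norm x)\<^sup>2))"
proof -
  define \<sigma> where "\<sigma> = 1 / sqrt (2 * \<delta>)"
  have \<sigma>: "\<sigma> > 0" "\<sigma>\<^sup>2 = 1 / (2 * \<delta>)"
    using assms by (auto simp: \<sigma>_def power_divide)
  have eq: "exp (- \<delta> * t\<^sup>2) = sqrt (2 * pi * \<sigma>\<^sup>2) * normal_density 0 \<sigma> t" for t
    using \<sigma> assms by (simp add: normal_density_def field_simps)
  have int1: "integrable lborel (\<lambda>t::real. exp (- \<delta> * t\<^sup>2))"
    unfolding eq using integrable_normal_density[OF \<sigma>(1)] by (intro integrable_mult_right) simp
  have fin1: "(\<integral>\<^sup>+t. ennreal (exp (- \<delta> * t\<^sup>2)) \<partial>(lborel::real measure)) < \<infinity>"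
    using int1 by (auto simp: integrable_iff_bounded)
  have fact: "ennreal (norm (exp (- \<delta> * (norm x)\<^sup>2))) = (\<Prod>b\<in>Basis. ennreal (exp (- \<delta> * (x \<bullet> b)\<^sup>2)))" for x :: 'a
  proof -
    have "(norm x)\<^sup>2 = (\<Sum>b\<in>Basis. (x \<bullet> b)\<^sup>2)"
      by (subst power2_norm_eq_inner, subst euclidean_inner) (simp add: power2_eq_square)
    then show ?thesis
      by (simp add: prod_ennreal exp_sum[symmetric] sum_negf sum_distrib_left)
  qed
  show ?thesis
    unfolding integrable_iff_bounded fact
    using fin1
    by (subst nn_integral_lborel_prod) (simp_all add: power_less_top_ennreal)
qed

text \<open>The difference quotient form of the derivative is the one that dominated convergence can handle.\<close>
lemma has_vector_derivative_iff_quotient: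
  fixes f :: "real \<Rightarrow> 'a::real_normed_vector"
  shows "(f has_vector_derivative D) (at t) \<longleftrightarrow> ((\<lambda>s. (f s - f t) /\<^sub>R (s - t)) \<longlongrightarrow> D) (at t)"
proof -
  have "norm ((f s - f t - (s - t) *\<^sub>R D) /\<^sub>R norm (s - t)) = norm ((f s - f t) /\<^sub>R (s - t) - D)"
    if "s \<noteq> t" for s
  proof -
    have "f s - f t - (s - t) *\<^sub>R D = (s - t) *\<^sub>R ((f s - f t) /\<^sub>R (s - t) - D)"
      using that by (simp add: scaleR_diff_right)
    then show ?thesis using that by (simp add: abs_mult)
  qed
  then have "((\<lambda>s. norm ((f s - f t - (s - t) *\<^sub>R D) /\<^sub>R norm (s - t))) \<longlongrightarrow> 0) (at t) \<longleftrightarrow>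
      ((\<lambda>s. norm ((f s - f t) /\<^sub>R (s - t) - D)) \<longlongrightarrow> 0) (at t)"
    by (intro filterlim_cong) (auto simp: eventually_at_filter)
  then show ?thesis
    unfolding has_vector_derivative_def has_derivative_at_within tendsto_norm_zero_iff
    by (simp add: bounded_linear_scaleR_left LIM_zero_iff)
qed

text \<open>By the mean value inequality a uniform bound on the derivative also bounds the difference
  quotients, so that dominated convergence applies to them.\<close>
lemma differentiate_integral:
  fixes f f' :: "real \<Rightarrow> 'a \<Rightarrow> complex"
  assumes int: "\<And>t. \<bar>t - t0\<bar> \<le> 1 \<Longrightarrow> integrable M (f t)"
    and deriv: "\<And>t x. \<bar>t - t0\<bar> \<le> 1 \<Longrightarrow> ((\<lambda>s. f s x) has_vector_derivative f' t x) (at t)"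
    and bound: "\<And>t x. \<bar>t - t0\<bar> \<le> 1 \<Longrightarrow> norm (f' t x) \<le> g x"
    and g: "integrable M g"
    and meas: "f' t0 \<in> borel_measurable M"
  shows "((\<lambda>t. \<integral>x. f t x \<partial>M) has_vector_derivative (\<integral>x. f' t0 x \<partial>M)) (at t0)"
proof -
  define q where "q t x = (f t x - f t0 x) /\<^sub>R (t - t0)" for t x
  have q_lim: "((\<lambda>t. q t x) \<longlongrightarrow> f' t0 x) (at t0)" for x
    using deriv[of t0 x] unfolding q_def has_vector_derivative_iff_quotient by simp
  have q_bound: "norm (q t x) \<le> g x" if "\<bar>t - t0\<bar> \<le> 1" "t \<noteq> t0" for t x
  proof -
    have "norm (f t x - f t0 x) \<le> g x * norm (t - t0)"
    proof (rule differentiable_bound[where S="cball t0 1" and f'="\<lambda>s h. h *\<^sub>R f' s x"])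
      fix s assume "s \<in> cball t0 1"
      then have s: "\<bar>s - t0\<bar> \<le> 1" by (simp add: dist_real_def abs_minus_commute)
      show "((\<lambda>t. f t x) has_derivative (\<lambda>h. h *\<^sub>R f' s x)) (at s within cball t0 1)"
        using deriv[OF s] by (simp add: has_vector_derivative_def has_derivative_at_withinI)
      show "onorm (\<lambda>h. h *\<^sub>R f' s x) \<le> g x"
        by (rule onorm_le) (use bound[OF s, of x] in \<open>simp add: mult.commute mult_left_mono\<close>)
    qed (use that in \<open>auto simp: dist_real_def\<close>)
    then show ?thesis
      using that unfolding q_def norm_scaleR by (simp add: inverse_eq_divide pos_divide_le_eq)
  qed
  have "((\<lambda>t. \<integral>x. q t x \<partial>M) \<longlongrightarrow> (\<integral>x. f' t0 x \<partial>M)) (at t0)"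
    unfolding tendsto_at_iff_sequentially comp_def
  proof safe
    fix X :: "nat \<Rightarrow> real"
    assume X: "\<forall>i. X i \<in> UNIV - {t0}" "X \<longlonglongrightarrow> t0"
    obtain N where N: "\<And>n. n \<ge> N \<Longrightarrow> \<bar>X n - t0\<bar> \<le> 1"
      using LIMSEQ_D[OF X(2), of 1] by (force intro: less_imp_le)
    have lim: "(\<lambda>n. q (X n) x) \<longlonglongrightarrow> f' t0 x" for x
      using q_lim[of x] X unfolding tendsto_at_iff_sequentially comp_def by auto
    show "(\<lambda>n. \<integral>x. q (X n) x \<partial>M) \<longlonglongrightarrow> (\<integral>x. f' t0 x \<partial>M)"
    proof (rule LIMSEQ_offset[where k = N], rule integral_dominated_convergence[where w = g])
      show "q (X (n + N)) \<in> borel_measurable M" for n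
        unfolding q_def using int[of t0] int[OF N[of "n + N"]]
        by (auto intro!: borel_measurable_scaleR borel_measurable_diff)
      show "AE x in M. (\<lambda>n. q (X (n + N)) x) \<longlonglongrightarrow> f' t0 x"
        using LIMSEQ_ignore_initial_segment[OF lim, of N] by simp
      show "AE x in M. norm (q (X (n + N)) x) \<le> g x" for n
        using q_bound[OF N[of "n + N"]] X by auto
    qed (use g meas in auto)
  qed
  moreover have "\<forall>\<^sub>F t in at t0. (\<integral>x. q t x \<partial>M) = ((\<integral>x. f t x \<partial>M) - (\<integral>x. f t0 x \<partial>M)) /\<^sub>R (t - t0)"
  proof -
    have "(\<integral>x. q t x \<partial>M) = ((\<integral>x. f t x \<partial>M) - (\<integral>x. f t0 x \<partial>M)) /\<^sub>R (t - t0)" if "\<bar>t - t0\<bar> \<le> 1" for t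
      unfolding q_def using int[OF that] int[of t0] by (simp add: integral_diff)
    then show ?thesis
      unfolding eventually_at by (intro exI[of _ 1]) (auto simp: dist_real_def)
  qed
  ultimately show ?thesis
    unfolding has_vector_derivative_iff_quotient by (rule Lim_transform_eventually)
qed

text \<open>Integration by parts in its basic form: by translation invariance of Lebesgue measure
  \<open>t \<mapsto> \<integral> f (x + t e) dx\<close> is constant, and differentiating it under the integral at \<open>t = 0\<close>
  gives \<open>\<integral> D\<close>.\<close>
lemma integral_directional_derivative_zero:
  fixes f D :: "'a::euclidean_space \<Rightarrow> complex"
  assumes deriv: "\<And>x. ((\<lambda>s. f (x + s *\<^sub>R e)) has_vector_derivative D x) (at 0)"
    and cont: "continuous_on UNIV f" "continuous_on UNIV D"
    and \<delta>: "\<delta> > 0"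
    and bound: "\<And>x. norm (f x) \<le> K * exp (- \<delta> * (norm x)\<^sup>2)" "\<And>x. norm (D x) \<le> K * exp (- \<delta> * (norm x)\<^sup>2)"
  shows "(\<integral>x. D x \<partial>lborel) = 0"
proof -
  have meas: "f \<in> borel_measurable borel" "D \<in> borel_measurable borel"
    using cont by (auto intro: borel_measurable_continuous_onI)
  have K: "K \<ge> 0"
    using order_trans[OF norm_ge_zero bound(1)[of 0]] by simp
  have f: "integrable lborel f"
    by (rule Bochner_Integration.integrable_bound[OF integrable_mult_right[where c = K, OF integrable_gaussian[OF \<delta>]]])
      (use meas bound K in auto)
  have inv: "(\<integral>x. f (x + c) \<partial>lborel) = (\<integral>x. f x \<partial>lborel)" for c
    by (subst lborel_distr_plus[of c, symmetric], subst integral_distr)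
      (use meas in \<open>auto simp: add.commute\<close>)
  have shift: "integrable lborel (\<lambda>x. f (x + c))" for c
    using f
    by (subst (asm) lborel_distr_plus[of c, symmetric], subst (asm) integrable_distr_eq)
      (use meas in \<open>auto simp: add.commute\<close>)
  \<comment> \<open>a majorant of all translates by \<open>t e\<close> with \<open>\<bar>t\<bar> \<le> 1\<close>; the exponent is halved because
    \<open>(norm x)\<^sup>2 \<le> 2 (norm (x + t e))\<^sup>2 + 2 (norm e)\<^sup>2\<close>\<close>
  define g where "g x = K * exp (\<delta> * (norm e)\<^sup>2) * exp (- (\<delta>/2) * (norm x)\<^sup>2)" for x :: 'a
  have "((\<lambda>t. \<integral>x. f (x + t *\<^sub>R e) \<partial>lborel) has_vector_derivative (\<integral>x. D (x + 0 *\<^sub>R e) \<partial>lborel)) (at 0)"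
  proof (rule differentiate_integral[where g = g and f' = "\<lambda>t x. D (x + t *\<^sub>R e)"])
    fix t :: real and x assume t: "\<bar>t - 0\<bar> \<le> 1"
    have "((\<lambda>s. f ((x + t *\<^sub>R e) + s *\<^sub>R e)) \<circ> (\<lambda>s. s - t) has_vector_derivative 1 *\<^sub>R D (x + t *\<^sub>R e)) (at t)"
      by (rule vector_diff_chain_at) (auto intro!: derivative_eq_intros deriv)
    then show "((\<lambda>s. f (x + s *\<^sub>R e)) has_vector_derivative D (x + t *\<^sub>R e)) (at t)"
      by (simp add: o_def algebra_simps)
    have "norm x \<le> norm (x + t *\<^sub>R e) + norm e"
    proof -
      have "norm x \<le> norm (x + t *\<^sub>R e) + norm (t *\<^sub>R e)" using norm_triangle_ineq4[of "x + t *\<^sub>R e" "t *\<^sub>R e"] by simp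
      also have "norm (t *\<^sub>R e) \<le> norm e" using t by (simp add: mult_left_le_one_le)
      finally show ?thesis by simp
    qed
    then have "(norm x)\<^sup>2 \<le> (norm (x + t *\<^sub>R e) + norm e)\<^sup>2" by (simp add: power_mono)
    also have "\<dots> \<le> 2 * (norm (x + t *\<^sub>R e))\<^sup>2 + 2 * (norm e)\<^sup>2"
      using sum_squares_bound[of "norm (x + t *\<^sub>R e)" "norm e"] by (simp add: power2_sum)
    finally have "- \<delta> * (norm (x + t *\<^sub>R e))\<^sup>2 \<le> \<delta> * (norm e)\<^sup>2 + - (\<delta>/2) * (norm x)\<^sup>2"
      using \<delta> by (simp add: field_simps) (metis distrib_left mult_le_cancel_left_pos mult.left_commute)
    then have "K * exp (- \<delta> * (norm (x + t *\<^sub>R e))\<^sup>2) \<le> g x"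
      unfolding g_def using K by (simp add: mult.assoc mult_exp_exp mult_left_mono)
    then show "norm (D (x + t *\<^sub>R e)) \<le> g x" using bound(2) order_trans by blast
  next
    show "integrable lborel g" unfolding g_def
      using \<delta> by (intro integrable_mult_right integrable_gaussian) simp
  qed (use shift meas in auto)
  then have "((\<lambda>t. \<integral>x. f x \<partial>lborel) has_vector_derivative (\<integral>x. D x \<partial>lborel)) (at 0)"
    by (simp add: inv)
  then show ?thesis
    using vector_derivative_unique_at[OF _ has_vector_derivative_const] by metis
qed

section \<open>Walks and loops\<close>

text \<open>The possible interiors of a self-avoiding walk through \<open>X\<close>: once the endpoints are outside \<open>X\<close>,
  they impose no further condition.\<close>
definition paths :: "'a set \<Rightarrow> 'a list set" where
  "paths X = {p. distinct p \<and> set p \<subseteq> X}"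

lemma finite_paths: "finite X \<Longrightarrow> finite (paths X)"
  using finite_subset_distinct[of X] by (simp add: paths_def conj_commute)

text \<open>The empty list is split off and the other lists are sorted by their last vertex. This mirrors the
  recursion that integration by parts produces for the two-point moments.\<close>
lemma sum_paths_last:
  fixes f :: "'a list \<Rightarrow> 'b::comm_monoid_add"
  assumes "finite X"
  shows "(\<Sum>p\<in>paths X. f p) = f [] + (\<Sum>y\<in>X. \<Sum>p\<in>paths (X - {y}). f (p @ [y]))"
proof -
  have eq: "paths X = insert [] (\<Union>y\<in>X. (\<lambda>p. p @ [y]) ` paths (X - {y}))" (is "_ = insert [] ?R")
  proof (intro set_eqI)
    fix p show "p \<in> paths X \<longleftrightarrow> p \<in> insert [] ?R"
      by (cases p rule: rev_cases) (auto simp: paths_def)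
  qed
  have fin: "finite (paths (X - {y}))" for y
    using assms by (intro finite_paths) simp
  have "(\<Sum>p\<in>?R. f p) = (\<Sum>y\<in>X. \<Sum>p\<in>(\<lambda>p. p @ [y]) ` paths (X - {y}). f p)"
    using assms fin by (intro sum.UNION_disjoint) auto
  also have "\<dots> = (\<Sum>y\<in>X. \<Sum>p\<in>paths (X - {y}). f (p @ [y]))"
    by (rule sum.cong[OF refl]) (simp add: sum.reindex inj_on_def)
  finally have "(\<Sum>p\<in>?R. f p) = (\<Sum>y\<in>X. \<Sum>p\<in>paths (X - {y}). f (p @ [y]))" .
  moreover have "(\<Sum>p\<in>paths X. f p) = f [] + (\<Sum>p\<in>?R. f p)"
    unfolding eq using assms fin by (subst sum.insert) auto
  ultimately show ?thesis by simp
qed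

lemma saws_in_eq_paths:
  assumes "X \<subseteq> UNIV - {a, b}"
  shows "saws_in X a b = (\<lambda>p. a # p @ [b]) ` paths X"
  using assms unfolding saws_in_def paths_def by auto

lemma walk_weight_Cons_Cons:
  "walk_weight C (x # y # zs) = C $ x $ y * walk_weight C (y # zs)"
proof -
  have "{1..length (x # y # zs) - 1} = insert 1 (Suc ` {1..length (y # zs) - 1})"
    by (auto simp: image_Suc_atLeastAtMost)
  then show ?thesis
    by (simp add: walk_weight_def prod.reindex image_iff nth_Cons' del: image_Suc_atLeastAtMost)
qed

lemma walk_weight_snoc:
  "walk_weight C (\<omega> @ [y, b]) = walk_weight C (\<omega> @ [y]) * C $ y $ b"
proof (induction \<omega>)
  case Nil
  show ?case by (simp add: walk_weight_Cons_Cons) (simp add: walk_weight_def)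
next
  case (Cons x \<omega>)
  then show ?case by (cases \<omega>) (simp_all add: walk_weight_Cons_Cons)
qed

lemma Field_cycle_edges: "Field (cycle_edges xs) = set xs"
proof -
  have "Range (cycle_edges xs) \<subseteq> set xs"
    unfolding cycle_edges_def by (auto intro!: nth_mem mod_less_divisor)
  moreover have "Domain (cycle_edges xs) = set xs"
    unfolding cycle_edges_def by (auto simp: in_set_conv_nth Domain_iff)
  ultimately show ?thesis unfolding Field_def by auto
qed

lemma cycle_edges_rotate:
  "cycle_edges (rotate k xs) = cycle_edges xs"
proof -
  have "cycle_edges (rotate1 xs) = cycle_edges xs" for xs :: "'a list"
  proof (cases "xs = []")
    case False
    define n where "n = length xs"
    define f where "f i = (xs ! i, xs ! (Suc i mod n))" for i
    have n: "n > 0" using False by (simp add: n_def)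
    have "(\<lambda>i. Suc i mod n) ` {..<n} = {..<n}"
    proof
      show "{..<n} \<subseteq> (\<lambda>i. Suc i mod n) ` {..<n}"
      proof
        fix j assume j: "j \<in> {..<n}"
        have "Suc ((j + (n - 1)) mod n) mod n = Suc (j + (n - 1)) mod n" by (rule mod_Suc_eq)
        also have "\<dots> = j" using j n by simp
        finally show "j \<in> (\<lambda>i. Suc i mod n) ` {..<n}"
          using n by (intro image_eqI[where x = "(j + (n - 1)) mod n"]) auto
      qed
    qed (use n in auto)
    moreover have "cycle_edges xs = f ` {..<n}"
      unfolding cycle_edges_def f_def n_def by auto
    moreover have "cycle_edges (rotate1 xs) = (\<lambda>i. f (Suc i mod n)) ` {..<n}"
      using n unfolding cycle_edges_def f_def n_def
      by (auto simp: nth_rotate1 image_iff intro!: exI)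
    ultimately show ?thesis by (metis image_image)
  qed simp
  then show ?thesis by (induction k) simp_all
qed

lemma cycle_edges_successor:
  assumes "distinct xs" "i < length xs"
  shows "(xs ! i, z) \<in> cycle_edges xs \<longleftrightarrow> z = xs ! (Suc i mod length xs)"
  using assms unfolding cycle_edges_def by (auto simp: nth_eq_iff_index_eq)

lemma card_cycle_edges:
  assumes "distinct xs"
  shows "card (cycle_edges xs) = length xs"
proof -
  have "cycle_edges xs = (\<lambda>i. (xs ! i, xs ! (Suc i mod length xs))) ` {..<length xs}"
    unfolding cycle_edges_def by auto
  moreover have "inj_on (\<lambda>i. (xs ! i, xs ! (Suc i mod length xs))) {..<length xs}"
    using assms by (auto simp: inj_on_def nth_eq_iff_index_eq)
  ultimately show ?thesis by (simp add: card_image)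
qed

text \<open>In a loop each vertex has exactly one successor, so following the edges from the root recovers
  the list.\<close>
lemma rooted_cycle_edges_inject:
  assumes "distinct (x # p)" "distinct (x # q)" "cycle_edges (x # p) = cycle_edges (x # q)"
  shows "p = q"
proof -
  have len: "length (x # p) = length (x # q)"
    using card_cycle_edges[OF assms(1)] card_cycle_edges[OF assms(2)] assms(3) by simp
  have "i < length (x # p) \<Longrightarrow> (x # p) ! i = (x # q) ! i" for i
  proof (induction i)
    case (Suc i)
    then have "((x # p) ! i, (x # p) ! Suc i) \<in> cycle_edges (x # p)"
      using cycle_edges_successor[OF assms(1), of i] by simp
    then have "((x # q) ! i, (x # p) ! Suc i) \<in> cycle_edges (x # q)"
      using Suc assms(3) by simp
    then show ?case
      using cycle_edges_successor[OF assms(2), of i] Suc.prems len by simp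
  qed simp
  then have "x # p = x # q" using len by (intro nth_equalityI) auto
  then show ?thesis by simp
qed

text \<open>A loop is unrooted, so it can be opened at any of its vertices.\<close>
lemma loop_through_rooted:
  assumes "\<gamma> \<in> loops" "x \<in> Field \<gamma>"
  obtains p where "distinct (x # p)" "\<gamma> = cycle_edges (x # p)"
proof -
  obtain xs where xs: "distinct xs" "\<gamma> = cycle_edges xs"
    using assms(1) unfolding loops_def by auto
  then have "x \<in> set xs" using assms(2) by (simp add: Field_cycle_edges)
  then obtain us vs where "xs = us @ x # vs" by (meson split_list)
  then have "rotate (length us) xs = x # vs @ us" by (simp add: rotate_append)
  then show thesis
    using xs cycle_edges_rotate[of "length us" xs] distinct_rotate[of "length us" xs]
    by (intro that[of "vs @ us"]) auto
qed

text \<open>A loop opened at \<open>x\<close> is a walk from \<open>x\<close> back to \<open>x\<close>.\<close>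
lemma prod_cycle_edges:
  assumes "distinct (x # p)"
  shows "(\<Prod>(u, v)\<in>cycle_edges (x # p). C $ u $ v) = walk_weight C (x # p @ [x])"
proof -
  let ?xs = "x # p" and ?n = "length (x # p)"
  have "cycle_edges ?xs = (\<lambda>i. (?xs ! i, ?xs ! (Suc i mod ?n))) ` {..<?n}"
    unfolding cycle_edges_def by auto
  moreover have "inj_on (\<lambda>i. (?xs ! i, ?xs ! (Suc i mod ?n))) {..<?n}"
    using assms by (intro inj_onI) (auto simp: nth_eq_iff_index_eq simp del: distinct.simps)
  ultimately have "(\<Prod>(u, v)\<in>cycle_edges ?xs. C $ u $ v) = (\<Prod>i<?n. C $ (?xs ! i) $ (?xs ! (Suc i mod ?n)))"
    by (simp add: prod.reindex del: length_Cons)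
  also have "\<dots> = (\<Prod>i<?n. C $ ((?xs @ [x]) ! i) $ ((?xs @ [x]) ! Suc i))"
  proof (rule prod.cong[OF refl])
    fix i assume "i \<in> {..<?n}"
    then have "i < ?n" by simp
    then have "(?xs @ [x]) ! i = ?xs ! i" "(?xs @ [x]) ! Suc i = ?xs ! (Suc i mod ?n)"
      by (simp_all add: nth_append mod_Suc del: append_Cons)
    then show "C $ (?xs ! i) $ (?xs ! (Suc i mod ?n)) = C $ ((?xs @ [x]) ! i) $ ((?xs @ [x]) ! Suc i)" by simp
  qed
  also have "\<dots> = walk_weight C (x # p @ [x])"
    unfolding walk_weight_def
    by (rule prod.reindex_bij_witness[where i = "\<lambda>i. i - 1" and j = Suc]) auto
  finally show ?thesis .
qed

lemma loops_nonempty_Field: "\<gamma> \<in> loops \<Longrightarrow> Field \<gamma> \<noteq> {}"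
  unfolding loops_def by (auto simp: Field_cycle_edges)

lemma finite_loop_configs: "finite (loop_configs X :: ('n::finite \<times> 'n) set set set)"
  by (rule finite_subset[OF subset_UNIV]) simp

text \<open>At most one loop of a configuration passes through \<open>x\<close>. If there is one, opening it at \<open>x\<close> gives a
  list of vertices in \<open>X\<close>, and the other loops must avoid these.\<close>
lemma loop_configs_insert:
  assumes "x \<notin> X"
  shows "loop_configs (insert x X) = loop_configs X \<union>
    (\<lambda>(p, \<Gamma>). insert (cycle_edges (x # p)) \<Gamma>) ` (SIGMA p:paths X. loop_configs (X - set p))"
    (is "_ = _ \<union> ?R")
proof (intro equalityI subsetI)
  fix \<Gamma> assume G: "\<Gamma> \<in> loop_configs (insert x X)"
  show "\<Gamma> \<in> loop_configs X \<union> ?R"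
  proof (cases "\<exists>\<gamma>\<in>\<Gamma>. x \<in> Field \<gamma>")
    case False
    then have "\<Gamma> \<in> loop_configs X" using G unfolding loop_configs_def by blast
    then show ?thesis by simp
  next
    case True
    then obtain \<gamma> where \<gamma>: "\<gamma> \<in> \<Gamma>" "x \<in> Field \<gamma>" by blast
    moreover have "\<gamma> \<in> loops" using G \<gamma> unfolding loop_configs_def by blast
    ultimately obtain p where p: "distinct (x # p)" "\<gamma> = cycle_edges (x # p)"
      by (metis loop_through_rooted)
    have F: "Field \<gamma> = insert x (set p)" by (simp add: p Field_cycle_edges)
    moreover have "Field \<gamma> \<subseteq> insert x X" using G \<gamma> unfolding loop_configs_def by blast
    ultimately have "p \<in> paths X" using p unfolding paths_def by auto
    moreover have "\<Gamma> - {\<gamma>} \<in> loop_configs (X - set p)"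
    proof -
      have "Field \<delta> \<subseteq> X - set p" if "\<delta> \<in> \<Gamma> - {\<gamma>}" for \<delta>
      proof -
        have "Field \<delta> \<inter> Field \<gamma> = {}" "Field \<delta> \<subseteq> insert x X"
          using that G \<gamma> unfolding loop_configs_def pairwise_def by blast+
        then show ?thesis using F by auto
      qed
      then show ?thesis using G unfolding loop_configs_def pairwise_def by auto
    qed
    moreover have "\<Gamma> = insert (cycle_edges (x # p)) (\<Gamma> - {\<gamma>})" using \<gamma> p by auto
    ultimately show ?thesis by (intro UnI2 image_eqI[where x = "(p, \<Gamma> - {\<gamma>})"]) auto
  qed
next
  fix \<Gamma> assume "\<Gamma> \<in> loop_configs X \<union> ?R"
  then show "\<Gamma> \<in> loop_configs (insert x X)"
  proof
    assume "\<Gamma> \<in> loop_configs X" then show ?thesis unfolding loop_configs_def by blast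
  next
    assume "\<Gamma> \<in> ?R"
    then obtain p \<Delta> where p: "p \<in> paths X" "\<Delta> \<in> loop_configs (X - set p)"
      and \<Gamma>: "\<Gamma> = insert (cycle_edges (x # p)) \<Delta>" by auto
    have "cycle_edges (x # p) \<in> loops"
      using p assms unfolding loops_def paths_def by (intro CollectI exI[of _ "x # p"]) auto
    moreover have "Field (cycle_edges (x # p)) = insert x (set p)" by (simp add: Field_cycle_edges)
    ultimately show ?thesis
      using p assms by (auto simp: \<Gamma> loop_configs_def paths_def pairwise_insert)
  qed
qed

text \<open>This is the recursion for the loop sums that the moments of \<open>\<Prod>\<^sub>x (1 + \<phi>\<^sub>x cnj \<phi>\<^sub>x)\<close> will be shown to
  satisfy as well, in \<open>moment_interaction_loops\<close>.\<close>
lemma sum_loop_configs_insert: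
  fixes C :: "complex ^ 'n ^ 'n"
  assumes "x \<notin> X"
  shows "(\<Sum>\<Gamma>\<in>loop_configs (insert x X). loop_weight C \<Gamma>) = (\<Sum>\<Gamma>\<in>loop_configs X. loop_weight C \<Gamma>) +
    (\<Sum>p\<in>paths X. walk_weight C (x # p @ [x]) * (\<Sum>\<Gamma>\<in>loop_configs (X - set p). loop_weight C \<Gamma>))"
proof -
  let ?S = "SIGMA p:paths X. (loop_configs (X - set p) :: ('n \<times> 'n) set set set)"
  let ?h = "\<lambda>(p, \<Gamma>). insert (cycle_edges (x # p)) \<Gamma>"
  have no_x: "x \<notin> Field \<gamma>" if "\<Gamma> \<in> loop_configs (X - Y)" "\<gamma> \<in> \<Gamma>" for \<Gamma> \<gamma> Y
    using that assms unfolding loop_configs_def by blast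
  have x_in: "x \<in> Field (cycle_edges (x # p))" for p by (simp add: Field_cycle_edges)
  have new: "cycle_edges (x # p) \<notin> \<Gamma>" if "\<Gamma> \<in> loop_configs (X - Y)" for \<Gamma> p Y
    using no_x[OF that] x_in by blast
  have inj: "inj_on ?h ?S"
  proof (rule inj_onI, clarify)
    fix p \<Gamma> q \<Delta>
    assume *: "p \<in> paths X" "\<Gamma> \<in> loop_configs (X - set p)" "q \<in> paths X" "\<Delta> \<in> loop_configs (X - set q)"
      and eq: "insert (cycle_edges (x # p)) \<Gamma> = insert (cycle_edges (x # q)) \<Delta>"
    have "cycle_edges (x # p) = cycle_edges (x # q)"
      using eq new[OF *(4), of p] by blast
    then have "p = q" using * assms by (intro rooted_cycle_edges_inject[of x]) (auto simp: paths_def)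
    moreover have "\<Gamma> = \<Delta>"
      using eq new[OF *(2), of p] new[OF *(4), of q] \<open>p = q\<close> by (metis insert_ident)
    ultimately show "p = q \<and> \<Gamma> = \<Delta>" by simp
  qed
  have disj: "loop_configs X \<inter> ?h ` ?S = {}"
    using no_x[of _ "{}"] x_in by fastforce
  have wt: "loop_weight C (insert (cycle_edges (x # p)) \<Gamma>) = walk_weight C (x # p @ [x]) * loop_weight C \<Gamma>"
    if "p \<in> paths X" "\<Gamma> \<in> loop_configs (X - set p)" for p \<Gamma>
  proof -
    have "distinct (x # p)" using that assms by (auto simp: paths_def)
    moreover have "finite \<Gamma>" using that by (simp add: loop_configs_def)
    ultimately show ?thesis
      unfolding loop_weight_def using new[OF that(2), of p] by (simp add: prod_cycle_edges)
  qed
  have finS: "finite ?S" by (intro finite_SigmaI finite_paths finite_loop_configs) simp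
  have "(\<Sum>\<Gamma>\<in>?h ` ?S. loop_weight C \<Gamma>) = (\<Sum>(p, \<Gamma>)\<in>?S. walk_weight C (x # p @ [x]) * loop_weight C \<Gamma>)"
    by (subst sum.reindex[OF inj]) (auto intro!: sum.cong simp: wt)
  also have "\<dots> = (\<Sum>p\<in>paths X. walk_weight C (x # p @ [x]) * (\<Sum>\<Gamma>\<in>loop_configs (X - set p). loop_weight C \<Gamma>))"
    by (subst sum.Sigma[symmetric]) (auto simp: sum_distrib_left finite_paths finite_loop_configs)
  finally show ?thesis
    unfolding loop_configs_insert[OF assms]
    using disj finS by (subst sum.union_disjoint) (auto simp: finite_loop_configs)
qed

section \<open>Sesquilinear forms and Wirtinger derivatives\<close>

definition form :: "complex ^ 'n ^ 'n \<Rightarrow> complex ^ 'n \<Rightarrow> complex" where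
  "form A \<phi> = (\<Sum>x\<in>UNIV. \<Sum>y\<in>UNIV. \<phi> $ x * A $ x $ y * cnj (\<phi> $ y))"

text \<open>The class of integrands: continuous functions that grow more slowly than every Gaussian. They
  contain the polynomials and form an algebra, and their product with a Gaussian weight still decays
  like a Gaussian.\<close>
definition tame :: "(complex ^ 'n \<Rightarrow> complex) \<Rightarrow> bool" where
  "tame F \<longleftrightarrow> continuous_on UNIV F \<and>
     (\<forall>\<epsilon>>0. \<exists>K. \<forall>\<phi>. norm (F \<phi>) \<le> K * exp (\<epsilon> * (norm \<phi>)\<^sup>2))"

lemma tame_const: "tame (\<lambda>\<phi>. c)"
  unfolding tame_def by (auto intro!: exI[of _ "norm c"] simp: mult_le_cancel_left1)

lemma tame_component: "tame (\<lambda>\<phi>. \<phi> $ x)"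
  unfolding tame_def
proof (intro conjI allI impI)
  fix \<epsilon> :: real assume \<epsilon>: "\<epsilon> > 0"
  have "norm (\<phi> $ x) \<le> (1 + 1 / \<epsilon>) * exp (\<epsilon> * (norm \<phi>)\<^sup>2)" for \<phi> :: "complex ^ 'a"
  proof -
    have "norm (\<phi> $ x) \<le> norm \<phi>" by (rule Finite_Cartesian_Product.norm_nth_le)
    also have "\<dots> \<le> 1 + (norm \<phi>)\<^sup>2" using sum_squares_bound[of 1 "norm \<phi>"] norm_ge_zero[of \<phi>] unfolding power_one by linarith
    also have "\<dots> \<le> (1 + 1 / \<epsilon>) * (1 + \<epsilon> * (norm \<phi>)\<^sup>2)"
      using \<epsilon> by (simp add: field_simps)
    also have "\<dots> \<le> (1 + 1 / \<epsilon>) * exp (\<epsilon> * (norm \<phi>)\<^sup>2)"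
      using \<epsilon> by (intro mult_left_mono exp_ge_add_one_self) auto
    finally show ?thesis .
  qed
  then show "\<exists>K. \<forall>\<phi>::complex ^ 'a. norm (\<phi> $ x) \<le> K * exp (\<epsilon> * (norm \<phi>)\<^sup>2)" by blast
qed (intro continuous_intros)

lemma tame_cnj: "tame F \<Longrightarrow> tame (\<lambda>\<phi>. cnj (F \<phi>))"
  unfolding tame_def by (auto intro: continuous_on_cnj)

lemma tame_add:
  assumes "tame F" "tame G"
  shows "tame (\<lambda>\<phi>. F \<phi> + G \<phi>)"
  unfolding tame_def
proof (intro conjI allI impI)
  fix \<epsilon> :: real assume "\<epsilon> > 0"
  then obtain K L where "\<And>\<phi>. norm (F \<phi>) \<le> K * exp (\<epsilon> * (norm \<phi>)\<^sup>2)"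
      "\<And>\<phi>. norm (G \<phi>) \<le> L * exp (\<epsilon> * (norm \<phi>)\<^sup>2)"
    using assms unfolding tame_def by meson
  then have "norm (F \<phi> + G \<phi>) \<le> (K + L) * exp (\<epsilon> * (norm \<phi>)\<^sup>2)" for \<phi>
    by (simp add: distrib_right norm_triangle_mono)
  then show "\<exists>K. \<forall>\<phi>. norm (F \<phi> + G \<phi>) \<le> K * exp (\<epsilon> * (norm \<phi>)\<^sup>2)" by blast
qed (use assms in \<open>auto simp: tame_def intro: continuous_on_add\<close>)

lemma tame_mult:
  assumes "tame F" "tame G"
  shows "tame (\<lambda>\<phi>. F \<phi> * G \<phi>)"
  unfolding tame_def
proof (intro conjI allI impI)
  fix \<epsilon> :: real assume "\<epsilon> > 0"
  then have "\<epsilon> / 2 > 0" by simp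
  then obtain K L where KL: "\<And>\<phi>. norm (F \<phi>) \<le> K * exp (\<epsilon> / 2 * (norm \<phi>)\<^sup>2)"
      "\<And>\<phi>. norm (G \<phi>) \<le> L * exp (\<epsilon> / 2 * (norm \<phi>)\<^sup>2)"
    using assms unfolding tame_def by meson
  have "norm (F \<phi> * G \<phi>) \<le> (K * L) * exp (\<epsilon> * (norm \<phi>)\<^sup>2)" for \<phi>
  proof -
    have "norm (F \<phi> * G \<phi>) \<le> (K * exp (\<epsilon> / 2 * (norm \<phi>)\<^sup>2)) * (L * exp (\<epsilon> / 2 * (norm \<phi>)\<^sup>2))"
      unfolding norm_mult
      by (rule mult_mono[OF KL order_trans[OF norm_ge_zero KL(1)] norm_ge_zero])
    also have "\<dots> = (K * L) * (exp (\<epsilon> / 2 * (norm \<phi>)\<^sup>2) * exp (\<epsilon> / 2 * (norm \<phi>)\<^sup>2))"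
      by (simp only: ac_simps)
    also have "\<dots> = (K * L) * exp (\<epsilon> * (norm \<phi>)\<^sup>2)"
      unfolding mult_exp_exp by (simp add: field_simps)
    finally show ?thesis .
  qed
  then show "\<exists>K. \<forall>\<phi>. norm (F \<phi> * G \<phi>) \<le> K * exp (\<epsilon> * (norm \<phi>)\<^sup>2)" by blast
qed (use assms in \<open>auto simp: tame_def intro: continuous_on_mult\<close>)

lemma tame_sum: "(\<And>i. i \<in> I \<Longrightarrow> tame (F i)) \<Longrightarrow> tame (\<lambda>\<phi>. \<Sum>i\<in>I. F i \<phi>)"
  by (induction I rule: infinite_finite_induct) (simp_all add: tame_const tame_add)

lemma tame_prod: "(\<And>i. i \<in> I \<Longrightarrow> tame (F i)) \<Longrightarrow> tame (\<lambda>\<phi>. \<Prod>i\<in>I. F i \<phi>)"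
  by (induction I rule: infinite_finite_induct) (simp_all add: tame_const tame_mult)

lemma tame_diff:
  assumes "tame F" "tame G"
  shows "tame (\<lambda>\<phi>. F \<phi> - G \<phi>)"
  using tame_add[OF assms(1) tame_mult[OF tame_const[of "-1"] assms(2)]] by simp

lemmas tame_intros = tame_const tame_component tame_cnj tame_add tame_mult tame_sum tame_prod tame_diff

lemma tame_form: "tame (form A)"
  unfolding form_def[abs_def] by (intro tame_intros)

text \<open>\<open>P\<close> and \<open>G\<close> are the Wirtinger derivatives \<open>\<partial>F/\<partial>\<phi>\<^sub>y\<close> and \<open>\<partial>F/\<partial>(cnj \<phi>\<^sub>y)\<close>, characterised through the real
  directional derivatives of \<open>F\<close> in all complex directions \<open>c\<close> of the coordinate \<open>y\<close>. Keeping both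
  makes the class closed under conjugation.\<close>
definition wirtinger ::
  "'n \<Rightarrow> (complex ^ 'n \<Rightarrow> complex) \<Rightarrow> (complex ^ 'n \<Rightarrow> complex) \<Rightarrow> (complex ^ 'n \<Rightarrow> complex) \<Rightarrow> bool" where
  "wirtinger y F P G \<longleftrightarrow> tame F \<and> tame P \<and> tame G \<and>
     (\<forall>\<phi> c. ((\<lambda>s. F (\<phi> + s *\<^sub>R axis y c)) has_vector_derivative c * P \<phi> + cnj c * G \<phi>) (at 0))"

lemma wirtinger_const: "wirtinger y (\<lambda>\<phi>. k) (\<lambda>\<phi>. 0) (\<lambda>\<phi>. 0)"
  unfolding wirtinger_def by (auto intro!: tame_intros)

lemma wirtinger_component:
  "wirtinger y (\<lambda>\<phi>. \<phi> $ x) (\<lambda>\<phi>. if x = y then 1 else 0) (\<lambda>\<phi>. 0)"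
  unfolding wirtinger_def
proof (intro conjI allI tame_intros)
  fix \<phi> and c :: complex
  have "((\<lambda>s::real. \<phi> $ x + s *\<^sub>R axis y c $ x) has_vector_derivative 1 *\<^sub>R axis y c $ x) (at 0)"
    by (auto intro!: derivative_eq_intros)
  then show "((\<lambda>s. (\<phi> + s *\<^sub>R axis y c) $ x) has_vector_derivative
      c * (if x = y then 1 else 0) + cnj c * 0) (at 0)"
    by (simp add: axis_def split: if_splits)
qed

lemma wirtinger_cnj:
  assumes "wirtinger y F P G"
  shows "wirtinger y (\<lambda>\<phi>. cnj (F \<phi>)) (\<lambda>\<phi>. cnj (G \<phi>)) (\<lambda>\<phi>. cnj (P \<phi>))"
proof -
  have "((\<lambda>s. cnj (F (\<phi> + s *\<^sub>R axis y c))) has_vector_derivative c * cnj (G \<phi>) + cnj c * cnj (P \<phi>)) (at 0)" for \<phi> c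
    using bounded_linear.has_vector_derivative[OF bounded_linear_cnj, of _ "c * P \<phi> + cnj c * G \<phi>" "at 0"] assms
    unfolding wirtinger_def by (simp add: add.commute)
  then show ?thesis using assms unfolding wirtinger_def by (auto intro: tame_intros)
qed

lemma wirtinger_cnj_component:
  "wirtinger y (\<lambda>\<phi>. cnj (\<phi> $ x)) (\<lambda>\<phi>. 0) (\<lambda>\<phi>. if x = y then 1 else 0)"
  using wirtinger_cnj[OF wirtinger_component[of y x]] by (simp add: if_distrib cong: if_cong)

lemma wirtinger_add:
  assumes "wirtinger y F P G" "wirtinger y F' P' G'"
  shows "wirtinger y (\<lambda>\<phi>. F \<phi> + F' \<phi>) (\<lambda>\<phi>. P \<phi> + P' \<phi>) (\<lambda>\<phi>. G \<phi> + G' \<phi>)"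
proof -
  have "((\<lambda>s. F (\<phi> + s *\<^sub>R axis y c) + F' (\<phi> + s *\<^sub>R axis y c)) has_vector_derivative
      (c * P \<phi> + cnj c * G \<phi>) + (c * P' \<phi> + cnj c * G' \<phi>)) (at 0)" for \<phi> c
    using assms unfolding wirtinger_def by (intro has_vector_derivative_add) auto
  then show ?thesis using assms unfolding wirtinger_def by (auto intro: tame_intros simp: algebra_simps)
qed

lemma wirtinger_mult:
  assumes "wirtinger y F P G" "wirtinger y F' P' G'"
  shows "wirtinger y (\<lambda>\<phi>. F \<phi> * F' \<phi>) (\<lambda>\<phi>. P \<phi> * F' \<phi> + F \<phi> * P' \<phi>) (\<lambda>\<phi>. G \<phi> * F' \<phi> + F \<phi> * G' \<phi>)"
proof -
  have "((\<lambda>s. F (\<phi> + s *\<^sub>R axis y c) * F' (\<phi> + s *\<^sub>R axis y c)) has_vector_derivative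
      F (\<phi> + 0 *\<^sub>R axis y c) * (c * P' \<phi> + cnj c * G' \<phi>) + (c * P \<phi> + cnj c * G \<phi>) * F' (\<phi> + 0 *\<^sub>R axis y c)) (at 0)" for \<phi> c
    using assms unfolding wirtinger_def by (intro has_vector_derivative_mult) auto
  then show ?thesis using assms unfolding wirtinger_def by (auto intro: tame_intros simp: algebra_simps)
qed

lemma wirtinger_sum:
  assumes "\<And>i. i \<in> I \<Longrightarrow> wirtinger y (F i) (P i) (G i)"
  shows "wirtinger y (\<lambda>\<phi>. \<Sum>i\<in>I. F i \<phi>) (\<lambda>\<phi>. \<Sum>i\<in>I. P i \<phi>) (\<lambda>\<phi>. \<Sum>i\<in>I. G i \<phi>)"
  using assms
  by (induction I rule: infinite_finite_induct) (simp_all add: wirtinger_const wirtinger_add)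

lemma wirtinger_form:
  "wirtinger y (form A) (\<lambda>\<phi>. \<Sum>z\<in>UNIV. A $ y $ z * cnj (\<phi> $ z)) (\<lambda>\<phi>. \<Sum>x\<in>UNIV. \<phi> $ x * A $ x $ y)"
proof -
  have "wirtinger y (form A)
    (\<lambda>\<phi>. \<Sum>x\<in>UNIV. \<Sum>z\<in>UNIV. ((if x = y then 1 else 0) * A $ x $ z + \<phi> $ x * 0) * cnj (\<phi> $ z) + (\<phi> $ x * A $ x $ z) * cnj 0)
    (\<lambda>\<phi>. \<Sum>x\<in>UNIV. \<Sum>z\<in>UNIV. (0 * A $ x $ z + \<phi> $ x * 0) * cnj (\<phi> $ z) + (\<phi> $ x * A $ x $ z) * cnj (if z = y then 1 else 0))"
    unfolding form_def[abs_def]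
    by (intro wirtinger_sum wirtinger_mult wirtinger_cnj wirtinger_component wirtinger_const)
  moreover have "(\<Sum>x\<in>UNIV. \<Sum>z\<in>UNIV. ((if x = y then 1 else 0) * A $ x $ z + \<phi> $ x * 0) * cnj (\<phi> $ z)
      + (\<phi> $ x * A $ x $ z) * cnj 0) = (\<Sum>z\<in>UNIV. A $ y $ z * cnj (\<phi> $ z))" for \<phi>
  proof -
    have "(\<Sum>z\<in>UNIV. ((if x = y then 1 else 0) * A $ x $ z + \<phi> $ x * 0) * cnj (\<phi> $ z)
      + (\<phi> $ x * A $ x $ z) * cnj 0) = (if x = y then \<Sum>z\<in>UNIV. A $ y $ z * cnj (\<phi> $ z) else 0)" for x
      by simp
    then show ?thesis by simp
  qed
  moreover have "(\<Sum>x\<in>UNIV. \<Sum>z\<in>UNIV. (0 * A $ x $ z + \<phi> $ x * 0) * cnj (\<phi> $ z)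
      + (\<phi> $ x * A $ x $ z) * cnj (if z = y then 1 else 0)) = (\<Sum>x\<in>UNIV. \<phi> $ x * A $ x $ y)" for \<phi>
    by (simp add: if_distrib[where f = cnj] if_distrib[where f = "\<lambda>u. _ * u"] cong: if_cong)
  ultimately show ?thesis by simp
qed

section \<open>Gaussian integration by parts\<close>

text \<open>The unnormalised Gaussian integral, in terms of \<open>A = C\<^sup>-\<^sup>1\<close> instead of \<open>C\<close>; the constant Jacobian
  factors \<open>2i\<close> are dropped because they cancel in the normalised integral.\<close>
definition moment :: "complex ^ 'n ^ 'n \<Rightarrow> (complex ^ 'n \<Rightarrow> complex) \<Rightarrow> complex" where
  "moment A F = (\<integral>w. exp (- form A (complex_field w)) * F (complex_field w) \<partial>lborel)"

lemma gauss_integral_eq_moment: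
  "gauss_integral C F = moment (matrix_inv C) F / moment (matrix_inv C) (\<lambda>_. 1)"
proof -
  have "field_integral (\<lambda>\<phi>. gauss_weight C \<phi> * G \<phi>) = moment (matrix_inv C) G * (2 * \<i>) ^ CARD('a)"
    for G :: "complex ^ 'a \<Rightarrow> complex"
    unfolding field_integral_def moment_def gauss_weight_def form_def by simp
  from this[of F] this[of "\<lambda>_. 1"] show ?thesis
    unfolding gauss_integral_def gauss_Z_def by simp
qed

definition coercive :: "real \<Rightarrow> complex ^ 'n ^ 'n \<Rightarrow> bool" where
  "coercive \<kappa> A \<longleftrightarrow> \<kappa> > 0 \<and> (\<forall>\<phi>. \<kappa> * (norm \<phi>)\<^sup>2 \<le> Re (form A \<phi>))"

lemma norm_complex_field: "norm (complex_field w) = norm w"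
proof (cases w)
  case (Pair u v)
  have "(\<Sum>x\<in>UNIV. (cmod (Complex (u $ x) (v $ x)))\<^sup>2) = (norm u)\<^sup>2 + (norm v)\<^sup>2"
    by (simp add: cmod_power2 sum.distrib norm_vec_def L2_set_def sum_nonneg)
  then show ?thesis
    by (simp add: Pair complex_field_def norm_prod_def norm_vec_def[of "vec_lambda _"] L2_set_def)
qed

lemma continuous_complex_field: "continuous_on S complex_field"
  unfolding complex_field_def case_prod_unfold Complex_eq
  by (intro continuous_on_vec_lambda continuous_intros)

text \<open>Half of the coercivity constant is spent on absorbing the growth of \<open>F\<close>.\<close>
lemma tame_weight_decay:
  assumes "coercive \<kappa> A" "tame F"
  obtains K where "K \<ge> 0" "\<And>\<phi>. norm (exp (- form A \<phi>) * F \<phi>) \<le> K * exp (- (\<kappa> / 2) * (norm \<phi>)\<^sup>2)"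
proof -
  have "\<kappa> / 2 > 0" using assms(1) by (simp add: coercive_def)
  then obtain K where K: "\<And>\<phi>. norm (F \<phi>) \<le> K * exp (\<kappa> / 2 * (norm \<phi>)\<^sup>2)"
    using assms(2) unfolding tame_def by blast
  have "norm (exp (- form A \<phi>) * F \<phi>) \<le> K * exp (- (\<kappa> / 2) * (norm \<phi>)\<^sup>2)" for \<phi>
  proof -
    have "norm (exp (- form A \<phi>) * F \<phi>) \<le> exp (- \<kappa> * (norm \<phi>)\<^sup>2) * (K * exp (\<kappa> / 2 * (norm \<phi>)\<^sup>2))"
      unfolding norm_mult norm_exp_eq_Re using assms(1)
      by (intro mult_mono K) (auto simp: coercive_def)
    also have "\<dots> = K * (exp (- \<kappa> * (norm \<phi>)\<^sup>2) * exp (\<kappa> / 2 * (norm \<phi>)\<^sup>2))"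
      by (simp only: ac_simps)
    also have "\<dots> = K * exp (- (\<kappa> / 2) * (norm \<phi>)\<^sup>2)"
      unfolding mult_exp_exp by (simp add: field_simps)
    finally show ?thesis .
  qed
  moreover have "K \<ge> 0" using order_trans[OF norm_ge_zero K[of 0]] by simp
  ultimately show thesis using that by blast
qed

lemma continuous_weighted:
  assumes "tame F"
  shows "continuous_on UNIV (\<lambda>w. exp (- form A (complex_field w)) * F (complex_field w))"
proof -
  have "continuous_on UNIV (\<lambda>\<phi>. exp (- form A \<phi>) * F \<phi>)"
    using assms tame_form[of A] unfolding tame_def by (intro continuous_intros) auto
  from continuous_on_compose2[OF this continuous_complex_field] show ?thesis by simp
qed

lemma integrable_weighted:
  assumes "coercive \<kappa> A" "tame F"
  shows "integrable lborel (\<lambda>w. exp (- form A (complex_field w)) * F (complex_field w))"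
proof -
  obtain K where K: "K \<ge> 0" "\<And>\<phi>. norm (exp (- form A \<phi>) * F \<phi>) \<le> K * exp (- (\<kappa> / 2) * (norm \<phi>)\<^sup>2)"
    using tame_weight_decay[OF assms] by blast
  have "\<kappa> / 2 > 0" using assms(1) by (simp add: coercive_def)
  then have "integrable lborel (\<lambda>w::(real ^ 'a) \<times> (real ^ 'a). K * exp (- (\<kappa> / 2) * (norm w)\<^sup>2))"
    by (intro integrable_mult_right integrable_gaussian)
  then show ?thesis
  proof (rule Bochner_Integration.integrable_bound)
    show "(\<lambda>w. exp (- form A (complex_field w)) * F (complex_field w)) \<in> borel_measurable lborel"
      using borel_measurable_continuous_onI[OF continuous_weighted[OF assms(2)]] by simp
    show "AE w in lborel. norm (exp (- form A (complex_field w)) * F (complex_field w))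
        \<le> norm (K * exp (- (\<kappa> / 2) * (norm w)\<^sup>2))"
      using K(2)[of "complex_field _"] K(1) by (auto simp: norm_complex_field)
  qed
qed

lemma moment_add:
  assumes "coercive \<kappa> A" "tame F" "tame G"
  shows "moment A (\<lambda>\<phi>. F \<phi> + G \<phi>) = moment A F + moment A G"
  unfolding moment_def distrib_left
  by (intro Bochner_Integration.integral_add integrable_weighted[OF assms(1)] assms)

lemma moment_cmult: "moment A (\<lambda>\<phi>. c * F \<phi>) = c * moment A F"
  unfolding moment_def by (simp add: mult.left_commute)

lemma moment_zero: "moment A (\<lambda>\<phi>. 0) = 0"
  unfolding moment_def by simp

lemma moment_sum:
  assumes "coercive \<kappa> A" "\<And>i. i \<in> I \<Longrightarrow> tame (F i)"
  shows "moment A (\<lambda>\<phi>. \<Sum>i\<in>I. F i \<phi>) = (\<Sum>i\<in>I. moment A (F i))"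
  using assms(2)
  by (induction I rule: infinite_finite_induct) (simp_all add: moment_zero moment_add[OF assms(1)] tame_sum)

lemma complex_field_line:
  "complex_field (w + s *\<^sub>R (axis y (Re c), axis y (Im c))) = complex_field w + s *\<^sub>R axis y c"
  by (cases w) (auto simp: complex_field_def vec_eq_iff axis_def complex_eq_iff)

text \<open>The integral of a directional derivative of \<open>exp (- form A) F\<close> vanishes. The directions \<open>c = 1\<close> and
  \<open>c = \<i>\<close> are combined as \<open>D\<^sub>1 + \<i> D\<^sub>\<i> = 2 \<partial>/\<partial>(cnj \<phi>\<^sub>y)\<close>, and the derivative of the weight produces the
  linear factor \<open>- \<Sum>\<^sub>x \<phi>\<^sub>x A\<^sub>x\<^sub>y\<close>.\<close>
lemma moment_integration_by_parts:
  assumes A: "coercive \<kappa> A" and F: "wirtinger y F P G"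
  shows "moment A (\<lambda>\<phi>. (\<Sum>x\<in>UNIV. \<phi> $ x * A $ x $ y) * F \<phi>) = moment A G"
proof -
  let ?L = "\<lambda>\<phi>. \<Sum>x\<in>UNIV. \<phi> $ x * A $ x $ y" and ?R = "\<lambda>\<phi>. \<Sum>z\<in>UNIV. A $ y $ z * cnj (\<phi> $ z)"
  \<comment> \<open>up to the weight, the derivative of \<open>exp (- form A) F\<close> in the direction \<open>c\<close>\<close>
  define T where "T c \<phi> = c * (P \<phi> - ?R \<phi> * F \<phi>) + cnj c * (G \<phi> - ?L \<phi> * F \<phi>)" for c \<phi>
  have tame: "tame F" "tame P" "tame G" using F by (auto simp: wirtinger_def)
  have tT: "tame (T c)" for c unfolding T_def[abs_def] by (intro tame_intros tame)
  have "moment A (T c) = 0" for c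
    unfolding moment_def
  proof -
    let ?f = "\<lambda>\<phi>. exp (- form A \<phi>) * F \<phi>"
    obtain K1 where K1: "\<And>\<phi>. norm (?f \<phi>) \<le> K1 * exp (- (\<kappa> / 2) * (norm \<phi>)\<^sup>2)"
      using tame_weight_decay[OF A tame(1)] by blast
    obtain K2 where K2: "\<And>\<phi>. norm (exp (- form A \<phi>) * T c \<phi>) \<le> K2 * exp (- (\<kappa> / 2) * (norm \<phi>)\<^sup>2)"
      using tame_weight_decay[OF A tT] by blast
    show "(\<integral>w. exp (- form A (complex_field w)) * T c (complex_field w) \<partial>lborel) = 0"
    proof (rule integral_directional_derivative_zero[where e = "(axis y (Re c), axis y (Im c))" and \<delta> = "\<kappa> / 2"
          and K = "max K1 K2" and f = "\<lambda>w. ?f (complex_field w)"])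
      fix w :: "(real ^ 'a) \<times> (real ^ 'a)"
      let ?\<phi> = "complex_field w"
      have dform: "((\<lambda>s. - form A (?\<phi> + s *\<^sub>R axis y c)) has_vector_derivative - (c * ?R ?\<phi> + cnj c * ?L ?\<phi>)) (at 0)"
        using wirtinger_form[of y A] unfolding wirtinger_def by (intro has_vector_derivative_minus) auto
      have "((exp \<circ> (\<lambda>s. - form A (?\<phi> + s *\<^sub>R axis y c))) has_vector_derivative
          - (c * ?R ?\<phi> + cnj c * ?L ?\<phi>) * exp (- form A (?\<phi> + 0 *\<^sub>R axis y c))) (at 0)"
        by (rule field_vector_diff_chain_at[OF dform]) (rule DERIV_exp)
      then have dexp: "((\<lambda>s. exp (- form A (?\<phi> + s *\<^sub>R axis y c))) has_vector_derivative
          - (c * ?R ?\<phi> + cnj c * ?L ?\<phi>) * exp (- form A ?\<phi>)) (at 0)"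
        by (simp add: o_def)
      have "((\<lambda>s. ?f (?\<phi> + s *\<^sub>R axis y c)) has_vector_derivative
          exp (- form A (?\<phi> + 0 *\<^sub>R axis y c)) * (c * P ?\<phi> + cnj c * G ?\<phi>)
          + (- (c * ?R ?\<phi> + cnj c * ?L ?\<phi>) * exp (- form A ?\<phi>)) * F (?\<phi> + 0 *\<^sub>R axis y c)) (at 0)"
        using F unfolding wirtinger_def by (intro has_vector_derivative_mult dexp) auto
      also have "exp (- form A (?\<phi> + 0 *\<^sub>R axis y c)) * (c * P ?\<phi> + cnj c * G ?\<phi>)
          + (- (c * ?R ?\<phi> + cnj c * ?L ?\<phi>) * exp (- form A ?\<phi>)) * F (?\<phi> + 0 *\<^sub>R axis y c)
        = exp (- form A ?\<phi>) * T c ?\<phi>"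
        unfolding T_def by (simp add: algebra_simps)
      finally show "((\<lambda>s. ?f (complex_field (w + s *\<^sub>R (axis y (Re c), axis y (Im c))))) has_vector_derivative
          exp (- form A ?\<phi>) * T c ?\<phi>) (at 0)"
        unfolding complex_field_line .
      show "norm (?f ?\<phi>) \<le> max K1 K2 * exp (- (\<kappa> / 2) * (norm w)\<^sup>2)"
        using K1[of ?\<phi>] unfolding norm_complex_field
        by (rule order_trans) (simp add: mult_right_mono)
      show "norm (exp (- form A ?\<phi>) * T c ?\<phi>) \<le> max K1 K2 * exp (- (\<kappa> / 2) * (norm w)\<^sup>2)"
        using K2[of ?\<phi>] unfolding norm_complex_field
        by (rule order_trans) (simp add: mult_right_mono)
    qed (use A continuous_weighted[OF tame(1)] continuous_weighted[OF tT] in \<open>auto simp: coercive_def\<close>)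
  qed
  then have "moment A (T 1) + \<i> * moment A (T \<i>) = 0" by simp
  also have "moment A (T 1) + \<i> * moment A (T \<i>) = moment A (\<lambda>\<phi>. T 1 \<phi> + \<i> * T \<i> \<phi>)"
    by (simp add: moment_add[OF A] moment_cmult tT tame_intros)
  also have "(\<lambda>\<phi>. T 1 \<phi> + \<i> * T \<i> \<phi>) = (\<lambda>\<phi>. 2 * (G \<phi> + (-1) * (?L \<phi> * F \<phi>)))"
    unfolding T_def by (auto simp: algebra_simps fun_eq_iff)
  also have "moment A \<dots> = 2 * (moment A G + (-1) * moment A (\<lambda>\<phi>. ?L \<phi> * F \<phi>))"
    unfolding moment_cmult
    by (subst moment_add[OF A], (intro tame_intros tame)+, subst moment_cmult, rule refl)
  finally show ?thesis by simp
qed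

text \<open>Writing \<open>\<phi>\<^sub>b = \<Sum>\<^sub>y (\<Sum>\<^sub>x \<phi>\<^sub>x A\<^sub>x\<^sub>y) C\<^sub>y\<^sub>b\<close> turns a factor \<open>\<phi>\<^sub>b\<close> into the factors that integration by parts
  removes. This is the Gaussian integration by parts formula
  \<open>E[\<phi>\<^sub>b F] = \<Sum>\<^sub>y C\<^sub>y\<^sub>b E[\<partial>F/\<partial>(cnj \<phi>\<^sub>y)]\<close>, valid for complex \<open>C\<close>.\<close>
lemma moment_component_mult:
  assumes A: "coercive \<kappa> A" and inv: "A ** C = mat 1"
    and F: "\<And>y. wirtinger y F (P y) (G y)"
  shows "moment A (\<lambda>\<phi>. \<phi> $ b * F \<phi>) = (\<Sum>y\<in>UNIV. C $ y $ b * moment A (G y))"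
proof -
  have "\<phi> $ b = (\<Sum>y\<in>UNIV. C $ y $ b * (\<Sum>x\<in>UNIV. \<phi> $ x * A $ x $ y))" for \<phi>
  proof -
    have "(\<Sum>y\<in>UNIV. C $ y $ b * (\<Sum>x\<in>UNIV. \<phi> $ x * A $ x $ y)) = (\<Sum>x\<in>UNIV. \<phi> $ x * (A ** C) $ x $ b)"
      unfolding matrix_matrix_mult_def
      by (simp add: sum_distrib_left mult.commute mult.left_commute) (rule sum.swap)
    also have "\<dots> = (\<Sum>x\<in>UNIV. if x = b then \<phi> $ x else 0)"
      unfolding inv by (intro sum.cong refl) (simp add: mat_def)
    finally show ?thesis by simp
  qed
  then have "\<phi> $ b * F \<phi> = (\<Sum>y\<in>UNIV. C $ y $ b * (\<Sum>x\<in>UNIV. \<phi> $ x * A $ x $ y)) * F \<phi>" for \<phi>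
    by (rule arg_cong)
  then have "moment A (\<lambda>\<phi>. \<phi> $ b * F \<phi>) =
      moment A (\<lambda>\<phi>. \<Sum>y\<in>UNIV. C $ y $ b * ((\<Sum>x\<in>UNIV. \<phi> $ x * A $ x $ y) * F \<phi>))"
    by (simp add: sum_distrib_right mult.assoc)
  also have "\<dots> = (\<Sum>y\<in>UNIV. C $ y $ b * moment A (\<lambda>\<phi>. (\<Sum>x\<in>UNIV. \<phi> $ x * A $ x $ y) * F \<phi>))"
    using F by (subst moment_sum[OF A]) (auto intro!: tame_intros simp: moment_cmult wirtinger_def)
  also have "\<dots> = (\<Sum>y\<in>UNIV. C $ y $ b * moment A (G y))"
    by (simp add: moment_integration_by_parts[OF A F])
  finally show ?thesis .
qed

section \<open>Coercivity of the inverse covariance\<close>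

lemma form_add_scale:
  "form (\<chi> x y. A $ x $ y + k * B $ x $ y) \<phi> = form A \<phi> + k * form B \<phi>"
  unfolding form_def by (simp add: algebra_simps sum.distrib sum_distrib_left)

lemma form_adjoint: "form (\<chi> x y. cnj (A $ y $ x)) \<phi> = cnj (form A \<phi>)"
  unfolding form_def by (simp add: ac_simps) (rule sum.swap)

lemma form_eq_mult_vec: "form A \<phi> = (\<Sum>x\<in>UNIV. \<phi> $ x * (A *v (\<chi> y. cnj (\<phi> $ y))) $ x)"
  unfolding form_def matrix_vector_mult_def by (simp add: sum_distrib_left mult.assoc)

lemma norm_conjugate_vec: "norm (\<chi> y. cnj (\<phi> $ y)) = norm (\<phi> :: complex ^ 'n)"
  by (simp add: norm_vec_def)

lemma form_scaleR: "form A (r *\<^sub>R \<phi>) = of_real (r\<^sup>2) * form A \<phi>"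
  unfolding form_def vector_scaleR_component by (simp add: sum_distrib_left power2_eq_square scaleR_conv_of_real ac_simps)

text \<open>By compactness the form has a positive minimum on the unit sphere, and it is homogeneous of
  degree two.\<close>
lemma coercive_if_pos:
  assumes pos: "\<And>\<phi>. \<phi> \<noteq> 0 \<Longrightarrow> 0 < Re (form A \<phi>)"
  obtains \<kappa> where "coercive \<kappa> (A :: complex ^ 'n ^ 'n)"
proof -
  have ne: "sphere (0 :: complex ^ 'n) 1 \<noteq> {}" by simp
  have "continuous_on (sphere 0 1) (\<lambda>\<phi>. Re (form A \<phi>))"
    using tame_form[of A] unfolding tame_def by (intro continuous_on_Re) (auto intro: continuous_on_subset)
  then obtain \<phi>0 where \<phi>0: "\<phi>0 \<in> sphere 0 1" "\<And>\<phi>. \<phi> \<in> sphere 0 1 \<Longrightarrow> Re (form A \<phi>0) \<le> Re (form A \<phi>)"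
    using continuous_attains_inf[OF compact_sphere ne] by blast
  let ?k = "Re (form A \<phi>0)"
  have "?k * (norm \<phi>)\<^sup>2 \<le> Re (form A \<phi>)" for \<phi>
  proof (cases "\<phi> = 0")
    case True then show ?thesis by (simp add: form_def)
  next
    case False
    then have "(1 / norm \<phi>) *\<^sub>R \<phi> \<in> sphere 0 1" by simp
    from \<phi>0(2)[OF this] have "?k \<le> (1 / norm \<phi>)\<^sup>2 * Re (form A \<phi>)" by (simp add: form_scaleR)
    then show ?thesis using False by (simp add: field_simps)
  qed
  moreover have "?k > 0" using \<phi>0(1) by (intro pos) auto
  ultimately show thesis using that unfolding coercive_def by blast
qed

lemma coercive_imp_invertible:
  assumes "coercive \<kappa> A"
  shows "invertible (A :: complex ^ 'n ^ 'n)"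
proof -
  have "v = 0" if "A *v v = 0" for v
  proof -
    have "\<kappa> * (norm v)\<^sup>2 \<le> Re (form A (\<chi> y. cnj (v $ y)))"
      using assms unfolding coercive_def by (metis norm_conjugate_vec)
    also have "form A (\<chi> y. cnj (v $ y)) = 0"
      unfolding form_eq_mult_vec by (simp add: that vec_lambda_eta)
    finally have "\<kappa> * (norm v)\<^sup>2 \<le> 0" by simp
    then show "v = 0" using assms by (auto simp: coercive_def mult_le_0_iff)
  qed
  then show ?thesis
    using matrix_left_invertible_ker[of A] invertible_left_inverse by blast
qed

text \<open>A column \<open>v\<close> of the inverse satisfies \<open>A v = e\<^sub>y\<close>, so coercivity gives \<open>\<kappa> (norm v)\<^sup>2 \<le> norm v\<close>. What matters
  is that the bound depends on \<open>\<kappa>\<close> alone.\<close>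
lemma norm_inverse_entry_le:
  assumes A: "coercive \<kappa> A" and inv: "A ** C = mat 1"
  shows "norm (C $ x $ y) \<le> 1 / \<kappa>"
proof -
  define v where "v = C *v axis y 1"
  have v: "v $ x = C $ x $ y" for x
    unfolding v_def by (simp add: matrix_vector_mult_def axis_def if_distrib cong: if_cong)
  have Av: "A *v v = axis y 1"
    unfolding v_def by (simp add: matrix_vector_mul_assoc inv)
  have "\<kappa> * (norm v)\<^sup>2 \<le> Re (form A (\<chi> y. cnj (v $ y)))"
    using A unfolding coercive_def by (metis norm_conjugate_vec)
  also have "form A (\<chi> y. cnj (v $ y)) = cnj (v $ y)"
    unfolding form_eq_mult_vec by (simp add: Av vec_lambda_eta axis_def if_distrib cong: if_cong)
  also have "Re (cnj (v $ y)) \<le> norm v"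
    using complex_Re_le_cmod[of "v $ y"] Finite_Cartesian_Product.norm_nth_le[of v y] by simp
  finally have "\<kappa> * norm v * norm v \<le> 1 * norm v" by (simp add: power2_eq_square)
  moreover have "norm v > 0"
    using Av by (auto simp: axis_eq_0_iff)
  ultimately have "\<kappa> * norm v \<le> 1" by simp
  then have "norm v \<le> 1 / \<kappa>" using A by (simp add: coercive_def field_simps)
  then show ?thesis using Finite_Cartesian_Product.norm_nth_le[of v x] by (simp add: v)
qed

text \<open>With \<open>\<psi> = A (cnj \<phi>)\<close>, the form of \<open>A\<close> at \<open>\<phi>\<close> is the complex conjugate of the form of \<open>C\<close> at \<open>cnj \<psi>\<close>.\<close>
lemma inverse_form_pos:
  assumes inv: "C ** A = mat 1" and pos: "\<And>\<phi>. \<phi> \<noteq> 0 \<Longrightarrow> 0 < Re (form C \<phi>)" and "\<phi> \<noteq> 0"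
  shows "0 < Re (form A \<phi>)"
proof -
  define \<psi> where "\<psi> = A *v (\<chi> y. cnj (\<phi> $ y))"
  have C\<psi>: "C *v \<psi> = (\<chi> y. cnj (\<phi> $ y))"
    unfolding \<psi>_def by (simp add: matrix_vector_mul_assoc inv)
  have "\<psi> \<noteq> 0"
  proof
    assume "\<psi> = 0"
    then have "(\<chi> y. cnj (\<phi> $ y)) = 0" using C\<psi> by simp
    then show False using \<open>\<phi> \<noteq> 0\<close> by (simp add: vec_eq_iff)
  qed
  then have "(\<chi> y. cnj (\<psi> $ y)) \<noteq> 0" by (simp add: vec_eq_iff)
  from pos[OF this] have "0 < Re (form C (\<chi> y. cnj (\<psi> $ y)))" .
  also have "form C (\<chi> y. cnj (\<psi> $ y)) = (\<Sum>x\<in>UNIV. cnj (\<psi> $ x) * cnj (\<phi> $ x))"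
    unfolding form_eq_mult_vec by (simp add: vec_lambda_eta C\<psi>)
  also have "\<dots> = cnj (form A \<phi>)"
    unfolding form_eq_mult_vec \<psi>_def by (simp add: mult.commute)
  finally show ?thesis by simp
qed

lemma positive_hermitian_part_imp_form_pos:
  assumes "positive_hermitian_part C" "\<phi> \<noteq> 0"
  shows "0 < Re (form C \<phi>)"
proof -
  have "(\<Sum>x\<in>UNIV. \<Sum>y\<in>UNIV. \<phi> $ x * (C $ x $ y + cnj (C $ y $ x)) * cnj (\<phi> $ y)) = form C \<phi> + cnj (form C \<phi>)"
    unfolding form_adjoint[symmetric] unfolding form_def by (simp add: algebra_simps sum.distrib)
  then show ?thesis using assms unfolding positive_hermitian_part_def by fastforce
qed

section \<open>The normalisation does not vanish\<close>

text \<open>A form of Gronwall's inequality: \<open>(norm (Z t))\<^sup>2 exp (2 L t)\<close> is nondecreasing.\<close>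
lemma nonzero_of_linear_derivative_bound:
  fixes Z Z' :: "real \<Rightarrow> complex"
  assumes deriv: "\<And>t. (Z has_vector_derivative Z' t) (at t)"
    and bound: "\<And>t. norm (Z' t) \<le> L * norm (Z t)" and "Z 0 \<noteq> 0"
  shows "Z 1 \<noteq> 0"
proof
  assume "Z 1 = 0"
  define u v where "u t = Re (Z t)" and "v t = Im (Z t)" for t
  define h where "h t = ((u t)\<^sup>2 + (v t)\<^sup>2) * exp (2 * L * t)" for t
  have hn: "h t = (norm (Z t))\<^sup>2 * exp (2 * L * t)" for t by (simp add: h_def u_def v_def cmod_power2)
  have "h 0 \<le> h 1"
  proof (rule DERIV_nonneg_imp_nondecreasing[of 0 1 h])
    fix t :: real
    have u: "(u has_real_derivative Re (Z' t)) (at t)"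
      using bounded_linear.has_vector_derivative[OF bounded_linear_Re deriv]
      by (simp add: has_real_derivative_iff_has_vector_derivative u_def[abs_def])
    have v: "(v has_real_derivative Im (Z' t)) (at t)"
      using bounded_linear.has_vector_derivative[OF bounded_linear_Im deriv]
      by (simp add: has_real_derivative_iff_has_vector_derivative v_def[abs_def])
    have "(h has_real_derivative (2 * u t * Re (Z' t) + 2 * v t * Im (Z' t)) * exp (2 * L * t)
        + ((u t)\<^sup>2 + (v t)\<^sup>2) * (exp (2 * L * t) * (2 * L))) (at t)"
      unfolding h_def[abs_def]
      by (auto intro!: derivative_eq_intros u v)
    also have "(2 * u t * Re (Z' t) + 2 * v t * Im (Z' t)) * exp (2 * L * t)
        + ((u t)\<^sup>2 + (v t)\<^sup>2) * (exp (2 * L * t) * (2 * L))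
      = 2 * (Re (cnj (Z t) * Z' t) + L * (norm (Z t))\<^sup>2) * exp (2 * L * t)"
      by (simp add: u_def v_def cmod_power2 algebra_simps)
    finally have "(h has_real_derivative
        2 * (Re (cnj (Z t) * Z' t) + L * (norm (Z t))\<^sup>2) * exp (2 * L * t)) (at t)" .
    moreover have "- (L * (norm (Z t))\<^sup>2) \<le> Re (cnj (Z t) * Z' t)"
    proof -
      have "\<bar>Re (cnj (Z t) * Z' t)\<bar> \<le> norm (Z t) * norm (Z' t)"
        using abs_Re_le_cmod[of "cnj (Z t) * Z' t"] by (simp add: norm_mult)
      also have "\<dots> \<le> norm (Z t) * (L * norm (Z t))" by (intro mult_left_mono bound) simp
      finally show ?thesis by (simp add: power2_eq_square ac_simps)
    qed
    ultimately show "\<exists>y. (h has_real_derivative y) (at t) \<and> 0 \<le> y"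
      by (intro exI conjI) auto
  qed simp
  then show False using assms(3) \<open>Z 1 = 0\<close> by (simp add: hn)
qed

lemma moment_one_nonzero_hermitian:
  assumes A: "coercive \<kappa> A" and real: "\<And>\<phi>. form A \<phi> \<in> \<real>"
  shows "moment A (\<lambda>_. 1) \<noteq> 0"
proof
  let ?g = "\<lambda>w. exp (- Re (form A (complex_field w)))"
  have eq: "exp (- form A \<phi>) * 1 = of_real (exp (- Re (form A \<phi>)))" for \<phi>
    using real[of \<phi>] by (simp add: exp_of_real[symmetric])
  have int: "integrable lborel (\<lambda>w. complex_of_real (?g w))"
    using integrable_weighted[OF A tame_const[of 1]] unfolding eq .
  then have int': "integrable lborel ?g" unfolding complex_of_real_integrable_eq .
  assume "moment A (\<lambda>_. 1) = 0"
  then have "(\<integral>w. ?g w \<partial>lborel) = 0"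
    unfolding moment_def eq by (simp add: integral_complex_of_real del: exp_of_real)
  then have "AE w in lborel. ?g w = 0"
    using integral_nonneg_eq_0_iff_AE[OF int'] by simp
  then have "AE w in (lborel :: ((real ^ 'a) \<times> (real ^ 'a)) measure). False" by simp
  then show False by (simp add: AE_iff_null null_sets_def)
qed

text \<open>The oscillating weight might integrate to zero. To exclude this, \<open>A\<close> is joined to its Hermitian
  part \<open>H\<close> by \<open>B t = H + t K\<close> with \<open>K\<close> skew-Hermitian. All \<open>B t\<close> share the coercivity constant of \<open>A\<close>,
  since \<open>K\<close> changes only the phase of the weight, and integration by parts evaluates the derivative:
  \<open>Z' = - (\<Sum>\<^sub>x\<^sub>y K\<^sub>x\<^sub>y C(t)\<^sub>y\<^sub>x) Z\<close> with \<open>C(t) = (B t)\<^sup>-\<^sup>1\<close>. The entries of \<open>C(t)\<close> are bounded uniformly in \<open>t\<close>,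
  and \<open>Z 0\<close> is the integral of a positive function, so \<open>Z\<close> stays nonzero.\<close>
lemma moment_one_nonzero:
  assumes A: "coercive \<kappa> (A :: complex ^ 'n ^ 'n)"
  shows "moment A (\<lambda>_. 1) \<noteq> 0"
proof -
  define H where "H = (\<chi> x y. (\<chi> x y. 1/2 * A $ x $ y) $ x $ y + 1/2 * (\<chi> x y. cnj (A $ y $ x)) $ x $ y)"
  define K where "K = (\<chi> x y. (\<chi> x y. 1/2 * A $ x $ y) $ x $ y + (- 1/2) * (\<chi> x y. cnj (A $ y $ x)) $ x $ y)"
  define B where "B t = (\<chi> x y. H $ x $ y + of_real t * K $ x $ y)" for t :: real
  have half: "form (\<chi> x y. 1/2 * A $ x $ y) \<phi> = form A \<phi> / 2" for \<phi>
    unfolding form_def by (simp add: sum_divide_distrib)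
  have H: "form H \<phi> = of_real (Re (form A \<phi>))" for \<phi>
    unfolding H_def form_add_scale half form_adjoint by (simp add: complex_eq_iff)
  have K: "form K \<phi> = \<i> * of_real (Im (form A \<phi>))" for \<phi>
    unfolding K_def form_add_scale half form_adjoint by (simp add: complex_eq_iff)
  have formB: "form (B t) \<phi> = of_real (Re (form A \<phi>)) + of_real t * form K \<phi>" for t \<phi>
    unfolding B_def form_add_scale H ..
  have ReB: "Re (form (B t) \<phi>) = Re (form A \<phi>)" for t \<phi> by (simp add: formB K)
  have B: "coercive \<kappa> (B t)" for t using A by (simp add: coercive_def ReB)
  have \<kappa>: "\<kappa> > 0" using A by (simp add: coercive_def)
  have B1: "B 1 = A" by (simp add: B_def H_def K_def vec_eq_iff)
  define Z where "Z t = moment (B t) (\<lambda>_. 1)" for t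
  define Z' where "Z' t = moment (B t) (\<lambda>\<phi>. - form K \<phi>)" for t
  have tK: "tame (\<lambda>\<phi>. - form K \<phi>)"
    using tame_mult[OF tame_const[of "-1"] tame_form[of K]] by simp
  have deriv: "(Z has_vector_derivative Z' t) (at t)" for t
  proof -
    obtain c where c: "\<And>\<phi>. norm (exp (- form A \<phi>) * (- form K \<phi>)) \<le> c * exp (- (\<kappa> / 2) * (norm \<phi>)\<^sup>2)"
      using tame_weight_decay[OF A tK] by blast
    show ?thesis
      unfolding Z_def[abs_def] Z'_def moment_def
    proof (rule differentiate_integral[where g = "\<lambda>w. c * exp (- (\<kappa> / 2) * (norm w)\<^sup>2)"])
      fix s and w :: "(real ^ 'n) \<times> (real ^ 'n)"
      let ?\<phi> = "complex_field w"
      have "((\<lambda>s. - form (B s) ?\<phi>) has_vector_derivative - form K ?\<phi>) (at s)"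
        unfolding formB by (auto intro!: derivative_eq_intros)
      from field_vector_diff_chain_at[OF this DERIV_exp]
      show "((\<lambda>s. exp (- form (B s) ?\<phi>) * 1) has_vector_derivative exp (- form (B s) ?\<phi>) * - form K ?\<phi>) (at s)"
        by (simp add: o_def mult.commute)
      have "norm (exp (- form (B s) ?\<phi>) * (- form K ?\<phi>)) = norm (exp (- form A ?\<phi>) * (- form K ?\<phi>))"
        by (simp add: norm_mult ReB)
      also have "\<dots> \<le> c * exp (- (\<kappa> / 2) * (norm w)\<^sup>2)"
        using c[of ?\<phi>] unfolding norm_complex_field .
      finally show "norm (exp (- form (B s) ?\<phi>) * (- form K ?\<phi>)) \<le> c * exp (- (\<kappa> / 2) * (norm w)\<^sup>2)" .
    next
      show "integrable lborel (\<lambda>w::(real ^ 'n) \<times> (real ^ 'n). c * exp (- (\<kappa> / 2) * (norm w)\<^sup>2))"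
        using \<kappa> by (intro integrable_mult_right integrable_gaussian) simp
      show "(\<lambda>w. exp (- form (B t) (complex_field w)) * - form K (complex_field w)) \<in> borel_measurable lborel"
        using borel_measurable_continuous_onI[OF continuous_weighted[OF tK]] by simp
    qed (rule integrable_weighted[OF B tame_const])
  qed
  define L where "L = (\<Sum>x\<in>UNIV. \<Sum>y\<in>UNIV. norm (K $ x $ y) * (1 / \<kappa>))"
  have bound: "norm (Z' t) \<le> L * norm (Z t)" for t
  proof -
    obtain C where C: "B t ** C = mat 1"
      using coercive_imp_invertible[OF B[of t]] invertible_right_inverse by blast
    have two: "moment (B t) (\<lambda>\<phi>. \<phi> $ x * cnj (\<phi> $ y)) = C $ y $ x * Z t" for x y
    proof -
      have "moment (B t) (\<lambda>\<phi>. \<phi> $ x * cnj (\<phi> $ y)) = (\<Sum>z\<in>UNIV. C $ z $ x * moment (B t) (\<lambda>\<phi>. if y = z then 1 else 0))"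
        by (rule moment_component_mult[OF B C wirtinger_cnj_component])
      also have "\<dots> = (\<Sum>z\<in>UNIV. if y = z then C $ z $ x * Z t else 0)"
        by (intro sum.cong refl) (simp add: Z_def moment_zero)
      finally show ?thesis by simp
    qed
    define k where "k x y = - (K $ x $ y)" for x y
    have "(\<lambda>\<phi>. - form K \<phi>) = (\<lambda>\<phi>. \<Sum>x\<in>UNIV. \<Sum>y\<in>UNIV. k x y * (\<phi> $ x * cnj (\<phi> $ y)))"
      unfolding form_def k_def by (simp add: sum_negf ac_simps)
    then have "Z' t = moment (B t) (\<lambda>\<phi>. \<Sum>x\<in>UNIV. \<Sum>y\<in>UNIV. k x y * (\<phi> $ x * cnj (\<phi> $ y)))"
      unfolding Z'_def by simp
    also have "\<dots> = (\<Sum>x\<in>UNIV. \<Sum>y\<in>UNIV. k x y * (C $ y $ x * Z t))"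
      by (simp add: moment_sum[OF B] tame_intros moment_cmult two)
    finally have "norm (Z' t) = norm (\<Sum>x\<in>UNIV. \<Sum>y\<in>UNIV. k x y * (C $ y $ x * Z t))" by simp
    also have "\<dots> \<le> (\<Sum>x\<in>UNIV. \<Sum>y\<in>UNIV. norm (K $ x $ y) * (1 / \<kappa>) * norm (Z t))"
    proof (intro sum_norm_le)
      fix x y
      have "norm (K $ x $ y) * norm (C $ y $ x) * norm (Z t) \<le> norm (K $ x $ y) * (1 / \<kappa>) * norm (Z t)"
        by (intro mult_right_mono mult_left_mono norm_inverse_entry_le[OF B C]) auto
      then show "norm (k x y * (C $ y $ x * Z t)) \<le> norm (K $ x $ y) * (1 / \<kappa>) * norm (Z t)"
        by (simp add: k_def norm_mult mult.assoc)
    qed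
    also have "\<dots> = L * norm (Z t)" unfolding L_def by (simp add: sum_distrib_right)
    finally show ?thesis .
  qed
  have "Z 0 \<noteq> 0"
    unfolding Z_def by (rule moment_one_nonzero_hermitian[OF B]) (simp add: formB)
  from nonzero_of_linear_derivative_bound[OF deriv bound this] show ?thesis by (simp add: Z_def B1)
qed

section \<open>Walk and loop expansions\<close>

abbreviation interaction :: "'n set \<Rightarrow> complex ^ 'n \<Rightarrow> complex" where
  "interaction X \<phi> \<equiv> \<Prod>x\<in>X. 1 + \<phi> $ x * cnj (\<phi> $ x)"

lemma wirtinger_interaction_factor:
  "wirtinger y (\<lambda>\<phi>. 1 + \<phi> $ x * cnj (\<phi> $ x))
     (\<lambda>\<phi>. if x = y then cnj (\<phi> $ y) else 0) (\<lambda>\<phi>. if x = y then \<phi> $ y else 0)"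
  using wirtinger_add[OF wirtinger_const[of y 1] wirtinger_mult[OF wirtinger_component[of y x] wirtinger_cnj_component[of y x]]]
  by (cases "x = y") simp_all

text \<open>Each factor contains one vertex only, so the derivative at \<open>y\<close> removes the factor of \<open>y\<close>.\<close>
lemma wirtinger_interaction:
  "wirtinger y (interaction X) (\<lambda>\<phi>. if y \<in> X then cnj (\<phi> $ y) * interaction (X - {y}) \<phi> else 0)
     (\<lambda>\<phi>. if y \<in> X then \<phi> $ y * interaction (X - {y}) \<phi> else 0)"
proof -
  \<comment> \<open>the factors other than that of \<open>y\<close> do not depend on \<open>\<phi>\<^sub>y\<close>\<close>
  have away: "wirtinger y (interaction Y) (\<lambda>\<phi>. 0) (\<lambda>\<phi>. 0)" if "y \<notin> Y" for Y
  proof -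
    have "finite Y" by simp
    then show ?thesis using that
    proof (induction Y)
      case empty show ?case using wirtinger_const[of y 1] by simp
    next
      case (insert x Y)
      then have "wirtinger y (interaction Y) (\<lambda>\<phi>. 0) (\<lambda>\<phi>. 0)" "x \<noteq> y" by auto
      from wirtinger_mult[OF wirtinger_interaction_factor[of y x] this(1)] this(2)
      show ?case using insert.hyps by simp
    qed
  qed
  show ?thesis
  proof (cases "y \<in> X")
    case True
    have "interaction X \<phi> = (1 + \<phi> $ y * cnj (\<phi> $ y)) * interaction (X - {y}) \<phi>" for \<phi> :: "complex ^ 'a"
      by (rule prod.remove) (use True in auto)
    with wirtinger_mult[OF wirtinger_interaction_factor[of y y] away[of "X - {y}"]] True
    show ?thesis by simp
  qed (simp add: away)
qed

text \<open>Removing \<open>\<phi>\<^sub>b\<close> by integration by parts leaves a derivative that hits either \<open>cnj \<phi>\<^sub>a\<close>, which ends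
  the walk with the step from \<open>a\<close> to \<open>b\<close>, or the factor of some \<open>y \<in> X\<close>, which gives a last step from
  \<open>y\<close> to \<open>b\<close> and uses up \<open>y\<close>.\<close>
lemma moment_two_point_step:
  assumes A: "coercive \<kappa> A" and inv: "A ** C = mat 1"
  shows "moment A (\<lambda>\<phi>. cnj (\<phi> $ a) * \<phi> $ b * interaction X \<phi>) =
    C $ a $ b * moment A (interaction X) +
    (\<Sum>y\<in>X. C $ y $ b * moment A (\<lambda>\<phi>. cnj (\<phi> $ a) * \<phi> $ y * interaction (X - {y}) \<phi>))"
proof -
  let ?G = "\<lambda>y \<phi>. (if a = y then 1 else 0) * interaction X \<phi>
      + cnj (\<phi> $ a) * (if y \<in> X then \<phi> $ y * interaction (X - {y}) \<phi> else 0)"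
  have G: "moment A (?G y) = (if a = y then moment A (interaction X) else 0) +
      (if y \<in> X then moment A (\<lambda>\<phi>. cnj (\<phi> $ a) * \<phi> $ y * interaction (X - {y}) \<phi>) else 0)" for y
  proof -
    have "moment A (?G y) = moment A (\<lambda>\<phi>. (if a = y then 1 else 0) * interaction X \<phi>) +
        moment A (\<lambda>\<phi>. cnj (\<phi> $ a) * (if y \<in> X then \<phi> $ y * interaction (X - {y}) \<phi> else 0))"
      using wirtinger_interaction[of y X] by (intro moment_add[OF A] tame_intros) (auto simp: wirtinger_def)
    then show ?thesis by (auto simp: moment_zero mult.assoc)
  qed
  have "moment A (\<lambda>\<phi>. cnj (\<phi> $ a) * \<phi> $ b * interaction X \<phi>)
      = moment A (\<lambda>\<phi>. \<phi> $ b * (cnj (\<phi> $ a) * interaction X \<phi>))"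
    by (simp only: ac_simps)
  also have "\<dots> = (\<Sum>y\<in>UNIV. C $ y $ b * moment A (?G y))"
    by (rule moment_component_mult[OF A inv wirtinger_mult[OF wirtinger_cnj_component wirtinger_interaction]])
  also have "\<dots> = (\<Sum>y\<in>UNIV. if a = y then C $ y $ b * moment A (interaction X) else 0) +
      (\<Sum>y\<in>UNIV. if y \<in> X then C $ y $ b * moment A (\<lambda>\<phi>. cnj (\<phi> $ a) * \<phi> $ y * interaction (X - {y}) \<phi>) else 0)"
    unfolding G sum.distrib[symmetric] by (intro sum.cong refl) (simp add: distrib_left)
  finally show ?thesis by (simp add: sum.If_cases)
qed

text \<open>Iteration of \<open>moment_two_point_step\<close> builds the walk backwards from \<open>b\<close>. It is self-avoiding because
  each visited vertex loses its factor \<open>1 + \<phi>\<^sub>y cnj \<phi>\<^sub>y\<close>.\<close>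
lemma moment_two_point_paths:
  assumes A: "coercive \<kappa> A" and inv: "A ** C = mat 1"
  shows "moment A (\<lambda>\<phi>. cnj (\<phi> $ a) * \<phi> $ b * interaction X \<phi>) =
    (\<Sum>p\<in>paths X. walk_weight C (a # p @ [b]) * moment A (interaction (X - set p)))"
proof -
  have "finite X" by simp
  then show ?thesis
  proof (induction X arbitrary: b rule: finite_psubset_induct)
    case (psubset X)
    have "moment A (\<lambda>\<phi>. cnj (\<phi> $ a) * \<phi> $ b * interaction X \<phi>) =
      C $ a $ b * moment A (interaction X) +
      (\<Sum>y\<in>X. C $ y $ b * (\<Sum>p\<in>paths (X - {y}). walk_weight C (a # p @ [y]) * moment A (interaction (X - {y} - set p))))"
      unfolding moment_two_point_step[OF A inv, of a b X]
      by (intro arg_cong2[where f = "(+)"] sum.cong refl, subst psubset.IH) auto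
    also have "\<dots> = (\<Sum>p\<in>paths X. walk_weight C (a # p @ [b]) * moment A (interaction (X - set p)))"
    proof -
      have "walk_weight C [a, b] = C $ a $ b" using walk_weight_Cons_Cons[of C a b "[]"] by (simp add: walk_weight_def)
      moreover have "walk_weight C (a # (p @ [y]) @ [b]) * moment A (interaction (X - set (p @ [y])))
          = C $ y $ b * (walk_weight C (a # p @ [y]) * moment A (interaction (X - {y} - set p)))" for p y
      proof -
        have "X - set (p @ [y]) = X - {y} - set p" by auto
        then show ?thesis using walk_weight_snoc[of C "a # p" y b] by simp
      qed
      ultimately show ?thesis
        by (subst sum_paths_last) (simp_all add: sum_distrib_left)
    qed
    finally show ?case .
  qed
qed

text \<open>Expanding one factor \<open>1 + \<phi>\<^sub>x cnj \<phi>\<^sub>x\<close> gives the configurations without a loop through \<open>x\<close> and a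
  two-point moment from \<open>x\<close> to \<open>x\<close>, that is, a sum over the loops through \<open>x\<close>.\<close>
lemma moment_interaction_loops:
  assumes A: "coercive \<kappa> A" and inv: "A ** C = mat 1"
  shows "moment A (interaction X) = (\<Sum>\<Gamma>\<in>loop_configs X. loop_weight C \<Gamma>) * moment A (\<lambda>_. 1)"
proof -
  have "finite X" by simp
  then show ?thesis
  proof (induction X rule: finite_psubset_induct)
    case (psubset X)
    show ?case
    proof (cases "X = {}")
      case True
      have "loop_configs {} = ({{}} :: ('a \<times> 'a) set set set)"
        using loops_nonempty_Field unfolding loop_configs_def by fastforce
      then show ?thesis by (simp add: True loop_weight_def)
    next
      case False
      then obtain x Y where X: "X = insert x Y" "x \<notin> Y" by (metis Set.set_insert equals0I)
      let ?Z = "moment A (\<lambda>_. 1)"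
      define S where "S Y = (\<Sum>\<Gamma>\<in>loop_configs Y. loop_weight C \<Gamma>)" for Y
      have "interaction X = (\<lambda>\<phi>. interaction Y \<phi> + cnj (\<phi> $ x) * \<phi> $ x * interaction Y \<phi>)"
        using X by (auto simp: fun_eq_iff algebra_simps)
      then have "moment A (interaction X) = moment A (interaction Y) + moment A (\<lambda>\<phi>. cnj (\<phi> $ x) * \<phi> $ x * interaction Y \<phi>)"
        by (simp add: moment_add[OF A] tame_intros)
      also have "\<dots> = moment A (interaction Y) + (\<Sum>p\<in>paths Y. walk_weight C (x # p @ [x]) * moment A (interaction (Y - set p)))"
        by (simp add: moment_two_point_paths[OF A inv])
      also have "\<dots> = S Y * ?Z + (\<Sum>p\<in>paths Y. walk_weight C (x # p @ [x]) * (S (Y - set p) * ?Z))"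
      proof -
        have "Y \<subset> X" "\<And>p. Y - set p \<subset> X" using X by auto
        then show ?thesis using psubset.IH by (simp add: S_def)
      qed
      also have "\<dots> = S X * ?Z"
        unfolding X(1) S_def sum_loop_configs_insert[OF X(2)] unfolding S_def[symmetric]
        by (simp add: distrib_right sum_distrib_right mult.assoc)
      finally show ?thesis by (simp add: S_def)
    qed
  qed
qed

theorem theorem2p8:
  fixes C :: "complex ^ 'n ^ 'n" and a b :: 'n and X :: "'n set"
  assumes "positive_hermitian_part C"
    and "X \<subseteq> UNIV - {a, b}"
  shows "gauss_integral C (\<lambda>\<phi>. cnj (\<phi> $ a) * \<phi> $ b * (\<Prod>x\<in>X. 1 + \<phi> $ x * cnj (\<phi> $ x))) =
           (\<Sum>\<omega>\<in>saws_in X a b. walk_weight C \<omega> *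
              gauss_integral C (\<lambda>\<phi>. \<Prod>x\<in>X - set \<omega>. 1 + \<phi> $ x * cnj (\<phi> $ x))) \<and>
         gauss_integral C (\<lambda>\<phi>. \<Prod>x\<in>X. 1 + \<phi> $ x * cnj (\<phi> $ x)) =
           (\<Sum>\<Gamma>\<in>loop_configs X. loop_weight C \<Gamma>) \<and>
         G_loop C a b =
           gauss_integral C
             (\<lambda>\<phi>. cnj (\<phi> $ a) * \<phi> $ b * (\<Prod>x\<in>{x. x \<noteq> a \<and> x \<noteq> b}. 1 + \<phi> $ x * cnj (\<phi> $ x)))"
proof -
  let ?A = "matrix_inv C" and ?E = "gauss_integral C"
  have pos: "0 < Re (form C \<phi>)" if "\<phi> \<noteq> 0" for \<phi>
    using positive_hermitian_part_imp_form_pos[OF assms(1) that] .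
  obtain \<kappa>' where "coercive \<kappa>' C" using coercive_if_pos[OF pos] by blast
  then have "invertible C" by (rule coercive_imp_invertible)
  then have inv: "C ** ?A = mat 1" "?A ** C = mat 1"
    unfolding invertible_def matrix_inv_def by (metis (mono_tags, lifting) someI_ex)+
  obtain \<kappa> where A: "coercive \<kappa> ?A"
    using coercive_if_pos[OF inverse_form_pos[OF inv(1) pos]] by blast
  note E = gauss_integral_eq_moment[of C]
  have loops: "?E (interaction Y) = (\<Sum>\<Gamma>\<in>loop_configs Y. loop_weight C \<Gamma>)" for Y
    unfolding E moment_interaction_loops[OF A inv(2)] using moment_one_nonzero[OF A] by simp
  have walks: "?E (\<lambda>\<phi>. cnj (\<phi> $ a) * \<phi> $ b * interaction Y \<phi>) =
      (\<Sum>\<omega>\<in>saws_in Y a b. walk_weight C \<omega> * ?E (interaction (Y - set \<omega>)))"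
    if Y: "Y \<subseteq> UNIV - {a, b}" for Y
  proof -
    have "Y - set (a # p @ [b]) = Y - set p" for p using Y by auto
    then show ?thesis
      unfolding saws_in_eq_paths[OF Y] E moment_two_point_paths[OF A inv(2)]
      by (subst sum.reindex) (auto simp: inj_on_def sum_divide_distrib)
  qed
  let ?Y = "{x. x \<noteq> a \<and> x \<noteq> b}"
  have "saws a b = saws_in ?Y a b" unfolding saws_in_def by auto
  moreover have "UNIV - set \<omega> = ?Y - set \<omega>" if "\<omega> \<in> saws_in ?Y a b" for \<omega>
    using that unfolding saws_in_def by auto
  ultimately have "G_loop C a b = (\<Sum>\<omega>\<in>saws_in ?Y a b. walk_weight C \<omega> * ?E (interaction (?Y - set \<omega>)))"
    unfolding G_loop_def by (simp add: loops sum_distrib_left)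
  also have "\<dots> = ?E (\<lambda>\<phi>. cnj (\<phi> $ a) * \<phi> $ b * interaction ?Y \<phi>)"
    by (rule walks[symmetric]) auto
  finally show ?thesis using walks[OF assms(2)] loops[of X] by simp
qed

end
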